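(* Consider the switched descriptor system $E_{\sigma(t)}\dot x=A_{\sigma(t)}x$, $\sigma(t)\in\{1,2\}$, with $E_i,A_i\in\mathbb{R}^{n\times n}$, $A_1,A_2$ nonsingular, in which every solution $x(\cdot)$ is continuous at the switching instants (i.e. $x(t_*^+)=x(t_*^-)$). Suppose: (a) $(E_1,A_1)$ and $(E_2,A_2)$ are stable; (b) $(E_1,A_1)$ has index zero and $(E_2,A_2)$ has index one; (c) there exist column vectors $g,h\in\mathbb{R}^n$ with $A_2^{-1}E_2=A_1^{-1}E_1-gh^T$, where $(A_1^{-1}E_1,g)$ is controllable and $(A_1^{-1}E_1,h)$ is observable (i.e. $(h^T,A_1^{-1}E_1)$ is an observable pair); (d) the matrix $A_1^{-1}E_1A_2^{-1}E_2$ has no negative real eigenvalues and exactly one zero eigenvalue. Then the switched system is GUES.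
   Context: For $E,A\in\mathbb{R}^{n\times n}$ with $A$ nonsingular, $(E,A)$ denotes the descriptor system $E\dot x=Ax$. It is stable if every root $s$ of $\det(sE-A)=0$ has negative real part. Its index is the smallest integer $k^*\ge0$ with $\mathrm{Im}((A^{-1}E)^{k^*+1})=\mathrm{Im}((A^{-1}E)^{k^*})$ (index zero means $E$ nonsingular), and its consistency space is $\mathcal{C}(E,A)=\mathrm{Im}((A^{-1}E)^{k^*})$. Switched descriptor system: the switching signal $\sigma$ is piecewise constant with finitely many discontinuities in every bounded interval; a solution $x(\cdot)$ is differentiable and satisfies $E_{\sigma(t)}\dot x(t)=A_{\sigma(t)}x(t)$ at every $t$ where $\sigma$ is continuous, with one-sided limits at the discontinuities of $\sigma$ (the equation is not required at those instants). The system is GUES if there exist $\beta,\alpha>0$ such that every solution satisfies $\|x(t)\|\le\beta e^{-\alpha(t-t_0)}\|x(t_0)\|$ for all $t\ge t_0$. *)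

theory Defs
  imports "HOL-Analysis.Analysis" "HOL-Computational_Algebra.Polynomial"
begin

type_synonym 'n rmat = "real^'n^'n"

primrec mpow :: "'n::finite rmat \<Rightarrow> nat \<Rightarrow> 'n rmat" where
  "mpow M 0 = mat 1"
| "mpow M (Suc k) = M ** mpow M k"

definition desc_stable :: "'n::finite rmat \<Rightarrow> 'n rmat \<Rightarrow> bool" where
  "desc_stable E A \<longleftrightarrow>
     (\<forall>s::complex. det (\<chi> i j. s * complex_of_real (E$i$j) - complex_of_real (A$i$j)) = 0
        \<longrightarrow> Re s < 0)"

definition desc_index :: "'n::finite rmat \<Rightarrow> 'n rmat \<Rightarrow> nat" where
  "desc_index E A =
     (LEAST k. range (\<lambda>v. mpow (matrix_inv A ** E) (Suc k) *v v)
             = range (\<lambda>v. mpow (matrix_inv A ** E) k *v v))"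

definition controllable :: "'n::finite rmat \<Rightarrow> real^'n \<Rightarrow> bool" where
  "controllable M g \<longleftrightarrow> span {mpow M k *v g | k. k < CARD('n)} = UNIV"

definition observable :: "real^'n \<Rightarrow> 'n::finite rmat \<Rightarrow> bool" where
  "observable h M \<longleftrightarrow> span {h v* mpow M k | k. k < CARD('n)} = UNIV"

definition charpoly :: "'n::finite rmat \<Rightarrow> real poly" where
  "charpoly P = det (\<chi> i j. (if i = j then [:0, 1:] else 0) - [:P$i$j:])"

text \<open>Switching signal with values in {1,2}, piecewise constant with finitely many
  discontinuities in every bounded interval (nat carries the discrete topology, so
  continuity at t means locally constant around t).\<close>
definition switching_signal :: "(real \<Rightarrow> nat) \<Rightarrow> bool" where
  "switching_signal \<sigma> \<longleftrightarrow> (\<forall>t. \<sigma> t \<in> {1, 2}) \<and>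
     (\<forall>a b. finite {t \<in> {a..b}. \<not> isCont \<sigma> t})"

definition switched_solution ::
  "(nat \<Rightarrow> 'n::finite rmat) \<Rightarrow> (nat \<Rightarrow> 'n rmat) \<Rightarrow> (real \<Rightarrow> nat) \<Rightarrow> real \<Rightarrow> (real \<Rightarrow> real^'n) \<Rightarrow> bool" where
  "switched_solution E A \<sigma> t0 x \<longleftrightarrow>
     continuous_on {t0..} x \<and>
     (\<forall>t>t0. isCont \<sigma> t \<longrightarrow>
        (\<exists>x'. (x has_vector_derivative x') (at t) \<and> E (\<sigma> t) *v x' = A (\<sigma> t) *v x t))"

definition GUES :: "(nat \<Rightarrow> 'n::finite rmat) \<Rightarrow> (nat \<Rightarrow> 'n rmat) \<Rightarrow> bool" where
  "GUES E A \<longleftrightarrow> (\<exists>\<beta>>0. \<exists>\<alpha>>0. \<forall>\<sigma> t0 x. switching_signal \<sigma> \<longrightarrow> switched_solution E A \<sigma> t0 x \<longrightarrow>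
      (\<forall>t\<ge>t0. norm (x t) \<le> \<beta> * exp (- \<alpha> * (t - t0)) * norm (x t0)))"

end

theory Submission
  imports Defs "HOL-Computational_Algebra.Fundamental_Theorem_Algebra"
begin

text \<open>
  Write $M = A_1^{-1}E_1$ and $N = A_2^{-1}E_2 = M - gh^T$, and let $v = M^{-1}g$, which spans the
  kernel of $N$. If $P > 0$ satisfies $x^TPMx < 0$ for $x \<noteq> 0$ and $N^TPv = 0$, then $x^TPx$
  decays exponentially in both modes: in the second one, $x = Nx'$, replace $x'$ by
  $y = x' - (h^Tx')v$; then $My = Ny = x$ and $x^TPx' = x^TPy = y^TM^TPy$.

  By separation of convex sets, if no such symmetric $P$ exists then there is a positive semidefinite
  $Z \<noteq> 0$ orthogonal to all the products $PM$. Controllability identifies row vectors with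
  polynomials of degree less than $n$ modulo an annihilating polynomial of $M$, in such a way that
  $Z$ becomes a form $L(p(s)q(-s))$ for a linear functional $L$ vanishing on odd polynomials.
  The remaining orthogonality condition says $L(e(-s^2)) = 0$ for one explicit polynomial $e$ of
  degree $n - 1$. A zero of $e$ at $y > 0$ makes $-y$ an eigenvalue of $MN$, and a zero at $0$
  makes $0$ a multiple eigenvalue of $MN$, so up to sign $e > 0$ on $[0, \<infinity>)$. Subtracting
  a small multiple of $\<Sum> y^i$ and factoring the rest of $e(-s^2)$ as $k(s)k(-s)$ forces $Z = 0$.

  Positivity of $P$ follows from stability of $M$ by iterating the Cayley transform of $M$.
\<close>

section \<open>Polynomials in a matrix acting on vectors\<close>

text \<open>As a simp rule it would turn \<open>transpose M *v x\<close> into \<open>x v* M\<close>.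
  Below, row vectors are treated as columns acted on by the transpose.\<close>

declare transpose_matrix_vector [simp del]

lemma matrix_vector_mult_smult:
  "(M::'a::comm_ring_1^'n^'m) *v (c *s x) = c *s (M *v x)"
  by (simp add: matrix_vector_mult_def vec_eq_iff sum_distrib_left algebra_simps)

text \<open>Horner's scheme for p(M) x. Scalars come from any commutative ring, so one calculus
  serves a real matrix and its complexification.\<close>

definition polyv :: "'a::comm_ring_1 poly \<Rightarrow> 'a^'n^'n \<Rightarrow> 'a^'n \<Rightarrow> 'a^'n::finite" where
  "polyv p M x = fold_coeffs (\<lambda>a y. a *s x + M *v y) p 0"

lemma polyv_0 [simp]: "polyv 0 M x = 0"
  by (simp add: polyv_def)

lemma polyv_pCons [simp]: "polyv (pCons a p) M x = a *s x + M *v polyv p M x"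
  by (cases "p = 0 \<and> a = 0") (auto simp: polyv_def)

lemma polyv_add: "polyv (p + q) M x = polyv p M x + polyv q M x"
proof (induction p q rule: poly_induct2)
  case (pCons a p b q)
  then show ?case
    by (simp add: matrix_vector_right_distrib vector_sadd_rdistrib algebra_simps)
qed simp

lemma polyv_smult: "polyv (smult c p) M x = c *s polyv p M x"
  by (induction p) (auto simp: matrix_vector_mult_smult vector_add_ldistrib)

lemma polyv_minus: "polyv (- p) M x = - polyv p M x"
  using polyv_smult[of "-1" p M x] by (simp add: vec_eq_iff)

lemma polyv_diff: "polyv (p - q) M x = polyv p M x - polyv q M x"
  using polyv_add[of p "- q" M x] by (simp add: polyv_minus)

lemma polyv_arg_add: "polyv p M (x + y) = polyv p M x + polyv p M y"
  by (induction p) (auto simp: matrix_vector_right_distrib vector_add_ldistrib)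

lemma polyv_arg_matrix: "polyv p M (M *v x) = M *v polyv p M x"
  by (induction p) (auto simp: matrix_vector_right_distrib matrix_vector_mult_smult)

lemma polyv_arg_0 [simp]: "polyv p M 0 = 0"
  by (induction p) auto

lemma polyv_mult: "polyv (p * q) M x = polyv p M (polyv q M x)"
  by (induction p) (auto simp: polyv_add polyv_smult)

lemma polyv_monom: "polyv (monom c k) M x = c *s (((*v) M ^^ k) x)"
  by (induction k) (auto simp: monom_0 monom_Suc matrix_vector_mult_smult)

lemma mpow_iterate: "mpow M k *v x = ((*v) M ^^ k) x"
  by (induction k) (auto simp flip: matrix_vector_mul_assoc)

lemma inner_transpose_vector: "x \<bullet> ((M::real^'n^'m) *v y) = (transpose M *v x) \<bullet> y"
  by (simp add: dot_lmul_matrix transpose_matrix_vector)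

lemma inner_polyv_transpose:
  "y \<bullet> polyv p (M::real^'n::finite^'n) x = polyv p (transpose M) y \<bullet> x"
proof (induction p arbitrary: y)
  case (pCons a p)
  then show ?case
    by (simp add: inner_add inner_transpose_vector polyv_arg_matrix scalar_mult_eq_scaleR
       )
qed simp

section \<open>Complexification of real vectors and matrices\<close>

definition cvec :: "real^'n \<Rightarrow> complex^'n" where "cvec x = (\<chi> i. complex_of_real (x$i))"
definition cmat :: "real^'n^'m \<Rightarrow> complex^'n^'m" where
  "cmat M = (\<chi> i j. complex_of_real (M$i$j))"

lemma cmat_cvec: "cmat M *v cvec x = cvec (M *v x)"
  by (simp add: cmat_def cvec_def matrix_vector_mult_def vec_eq_iff)

lemma cmat_mult: "cmat (A ** B) = cmat A ** cmat B"
  by (simp add: cmat_def matrix_matrix_mult_def vec_eq_iff)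

lemma cmat_1 [simp]: "cmat (mat 1) = mat 1"
  by (simp add: cmat_def mat_def vec_eq_iff)

lemma Re_cmat_mult: "(\<chi> i. Re ((cmat M *v z)$i)) = M *v (\<chi> i. Re (z$i))"
  by (simp add: cmat_def matrix_vector_mult_def vec_eq_iff)

lemma cvec_polyv: "polyv (map_poly complex_of_real p) (cmat M) (cvec x) = cvec (polyv p M x)"
proof (induction p)
  case 0
  then show ?case by (simp add: cvec_def vec_eq_iff)
next
  case (pCons a p)
  have "polyv (map_poly complex_of_real (pCons a p)) (cmat M) (cvec x)
      = complex_of_real a *s cvec x + cmat M *v cvec (polyv p M x)"
    using pCons by (simp add: map_poly_pCons)
  also have "\<dots> = cvec (a *s x + M *v polyv p M x)"
    unfolding cmat_cvec by (simp add: cvec_def vec_eq_iff)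
  finally show ?case by simp
qed

text \<open>M and x are real, so only the coefficients of p carry imaginary parts. This lets a
  non-vanishing result over the reals show that a complex combination is nonzero.\<close>

lemma Re_polyv: "(\<chi> i. Re (polyv p (cmat M) (cvec x) $ i)) = polyv (map_poly Re p) M x"
proof (induction p)
  case 0
  then show ?case by (simp add: vec_eq_iff)
next
  case (pCons a p)
  have "(\<chi> i. Re (polyv (pCons a p) (cmat M) (cvec x) $ i))
      = Re a *s x + (\<chi> i. Re ((cmat M *v polyv p (cmat M) (cvec x)) $ i))"
    by (simp add: vec_eq_iff cvec_def)
  also have "\<dots> = Re a *s x + M *v polyv (map_poly Re p) M x"
    using pCons by (simp add: Re_cmat_mult)
  finally show ?case using pCons(1) by (simp add: map_poly_pCons)
qed

section \<open>Even polynomials positive on the imaginary axis\<close>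

lemma poly_complex_of_real_poly:
  "poly (map_poly complex_of_real p) (complex_of_real x) = complex_of_real (poly p x)"
  by (induction p) (auto simp: map_poly_pCons)

lemma map_poly_complex_of_real_mult:
  "map_poly complex_of_real (p * q) = map_poly complex_of_real p * map_poly complex_of_real q"
  by (intro poly_eqI) (simp add: coeff_map_poly coeff_mult)

lemma map_poly_complex_of_real_add:
  "map_poly complex_of_real (p + q) = map_poly complex_of_real p + map_poly complex_of_real q"
  by (intro poly_eqI) (simp add: coeff_map_poly)

lemma map_poly_complex_of_real_smult:
  "map_poly complex_of_real (smult c p) = smult (complex_of_real c) (map_poly complex_of_real p)"
  by (intro poly_eqI) (simp add: coeff_map_poly)

lemma poly_map_complex_of_real_cnj:
  "poly (map_poly complex_of_real p) (cnj z) = cnj (poly (map_poly complex_of_real p) z)"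
  by (induction p) (auto simp: map_poly_pCons)

text \<open>The quadratic is (s - z)(s - cnj z). The remainder of p modulo it is a real polynomial
  of degree at most 1 with a root off the real line, hence zero.\<close>

lemma real_quadratic_dvd_of_complex_root:
  fixes p :: "real poly"
  assumes root: "poly (map_poly complex_of_real p) z = 0" and z: "Im z \<noteq> 0"
  shows "[:(cmod z)\<^sup>2, - 2 * Re z, 1:] dvd p"
proof -
  let ?Q = "[:(cmod z)\<^sup>2, - 2 * Re z, 1:]"
  define r where "r = p mod ?Q"
  have Q0: "?Q \<noteq> 0" by simp
  have "degree r < 2" unfolding r_def
    using degree_mod_less'[of ?Q p] Q0 by (cases "p mod ?Q = 0") (auto simp: numeral_2_eq_2)
  then have "coeff r k = coeff [:coeff r 0, coeff r 1:] k" for k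
    by (auto simp: coeff_pCons coeff_eq_0 split: nat.split)
  then obtain a b where r: "r = [:a, b:]" by (metis poly_eqI)
  have "p = ?Q * (p div ?Q) + r" by (simp only: r_def mult_div_mod_eq)
  then have "map_poly complex_of_real p = map_poly complex_of_real ?Q
      * map_poly complex_of_real (p div ?Q) + map_poly complex_of_real r"
    by (metis map_poly_complex_of_real_mult map_poly_complex_of_real_add)
  moreover have "poly (map_poly complex_of_real ?Q) z = 0"
    by (simp add: map_poly_pCons complex_eq_iff cmod_power2) (simp add: power2_eq_square algebra_simps)
  ultimately have "poly (map_poly complex_of_real r) z = 0"
    using root by simp
  then have "r = 0" using z by (auto simp: r map_poly_pCons complex_eq_iff)
  then show ?thesis by (simp add: r_def dvd_eq_mod_eq_0)
qed

text \<open>The polynomial p(-s). On the imaginary axis its value is the conjugate of p(s), so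
  \<open>k * reflect k\<close> is |k|^2 there.\<close>

abbreviation reflect :: "real poly \<Rightarrow> real poly" where
  "reflect p \<equiv> p \<circ>\<^sub>p [:0, -1:]"

lemma reflect_reflect [simp]: "reflect (reflect p) = p"
  by (simp add: pcompose_assoc[symmetric] pcompose_pCons pcompose_idR)

lemma coeff_reflect: "coeff (reflect p) k = (-1) ^ k * coeff p k"
  by (induction p arbitrary: k) (auto simp: pcompose_pCons coeff_pCons split: nat.split)

lemma degree_reflect [simp]: "degree (reflect p) = degree p"
  by (simp add: degree_pcompose)

text \<open>Odd coefficients vanish, and removing the two lowest ones keeps the polynomial even. The
  inner polynomial is -s^2, so that s = i sqrt y corresponds to an argument y \<ge> 0.\<close>

lemma even_poly_as_square_composition:
  fixes p :: "real poly"
  assumes "reflect p = p"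
  shows "\<exists>e. p = e \<circ>\<^sub>p [:0, 0, -1:]"
  using assms
proof (induction "degree p" arbitrary: p rule: less_induct)
  case less
  show ?case
  proof (cases "degree p = 0")
    case True
    then obtain a where "p = [:a:]" by (metis degree_eq_zeroE)
    then show ?thesis by (intro exI[of _ "[:a:]"]) simp
  next
    case False
    obtain a b q where p: "p = pCons a (pCons b q)" by (metis pCons_cases)
    have c: "(-1) ^ k * coeff p k = coeff p k" for k
      using less.prems by (metis coeff_reflect)
    have b: "b = 0" using c[of 1] by (simp add: p)
    have "coeff (reflect q) k = coeff q k" for k
      using c[of "Suc (Suc k)"] by (simp add: p coeff_reflect)
    then have "reflect q = q" by (intro poly_eqI)
    moreover have "degree q < degree p"
      using False by (auto simp: p b split: if_splits)
    ultimately obtain e where e: "q = e \<circ>\<^sub>p [:0, 0, -1:]" using less.hyps by blast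
    show ?thesis
      by (intro exI[of _ "pCons a (- e)"]) (simp add: p b e pcompose_pCons pcompose_uminus)
  qed
qed

text \<open>Spectral factorization, splitting off one irreducible real factor of e at a
  time.\<close>

lemma positive_on_nonneg_spectral_factor:
  fixes e :: "real poly"
  assumes "\<And>y. y \<ge> 0 \<Longrightarrow> poly e y > 0"
  shows "\<exists>k. degree k = degree e \<and> e \<circ>\<^sub>p [:0, 0, -1:] = k * reflect k"
  using assms
proof (induction "degree e" arbitrary: e rule: less_induct)
  case less
  show ?case
  proof (cases "degree e = 0")
    case True
    then obtain a where e: "e = [:a:]" by (metis degree_eq_zeroE)
    then have "a > 0" using less.prems[of 0] by simp
    then show ?thesis by (intro exI[of _ "[:sqrt a:]"]) (simp add: e)
  next
    case False
    then have "\<not> constant (poly (map_poly complex_of_real e))"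
      by (simp add: constant_degree degree_map_poly)
    then obtain z where z: "poly (map_poly complex_of_real e) z = 0"
      using fundamental_theorem_of_algebra by blast
    \<comment> \<open>Once the factor f has a spectral factor k, the cofactor is again positive for
      y \<ge> 0 and has smaller degree, so the induction supplies its spectral factor.\<close>
    have step: ?thesis if f: "e = f * e'" "degree f > 0" "\<And>y. y \<ge> 0 \<Longrightarrow> poly f y > 0"
        "degree k = degree f" "f \<circ>\<^sub>p [:0, 0, -1:] = k * reflect k" for f e' k
    proof -
      have pos: "poly e' y > 0" if "y \<ge> 0" for y
        using less.prems[OF that] f(3)[OF that] by (simp add: f(1) zero_less_mult_iff)
      have "e' \<noteq> 0" using pos[of 0] by auto
      moreover have "f \<noteq> 0" using f(2) by auto
      ultimately have deg: "degree e = degree f + degree e'" 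
        by (simp add: f(1) degree_mult_eq)
      then obtain k' where k': "degree k' = degree e'" "e' \<circ>\<^sub>p [:0, 0, -1:] = k' * reflect k'"
        using less.hyps[of e'] pos f(2) by auto
      have "k \<noteq> 0"  using f(2,4) by auto
      moreover have "k' \<noteq> 0" using k'(2) \<open>e' \<noteq> 0\<close> by (auto simp: pcompose_eq_0_iff)
      ultimately have "degree (k * k') = degree e"
        by (simp add: degree_mult_eq deg f(4) k'(1))
      moreover have "e \<circ>\<^sub>p [:0, 0, -1:] = (k * k') * reflect (k * k')"
        by (simp add: f(1,5) k'(2) pcompose_mult algebra_simps)
      ultimately show ?thesis by blast
    qed
    show ?thesis
    proof (cases "Im z = 0")
      case True
      then have "z = complex_of_real (Re z)" by (simp add: complex_eq_iff)
      then have "poly e (Re z) = 0" using z poly_complex_of_real_poly[of e "Re z"] by auto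
      then have dvd: "[:- Re z, 1:] dvd e" and neg: "Re z < 0"
        using less.prems[of "Re z"] by (simp add: poly_eq_0_iff_dvd, force)
      obtain e' where e': "e = [:- Re z, 1:] * e'" using dvd by (auto elim: dvdE)
      show ?thesis
        \<comment> \<open>With r = Re z < 0, the factor y - r at y = -s^2 is (sqrt (-r) + s)(sqrt
          (-r) - s).\<close>
        using neg by (intro step[OF e', where k = "[:sqrt (- Re z), 1:]"])
          (auto simp: pcompose_pCons add_nonneg_pos)
    next
      case False
      \<comment> \<open>At y = -s^2 the quadratic becomes s^4 + 2 Re z s^2 + |z|^2. The product (s^2
        + \<alpha> s + \<beta>)(s^2 - \<alpha> s + \<beta>) has s^2-coefficient 2 \<beta> -
        \<alpha>^2 and constant term \<beta>^2, which determines both constants.\<close>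
      define \<beta> where "\<beta> = cmod z"
      define \<alpha> where "\<alpha> = sqrt (2 * (cmod z - Re z))"
      have a2: "\<alpha> * \<alpha> = 2 * (\<beta> - Re z)"
        using complex_Re_le_cmod[of z] by (simp add: \<alpha>_def \<beta>_def)
      obtain e' where e': "e = [:(cmod z)\<^sup>2, - 2 * Re z, 1:] * e'"
        using real_quadratic_dvd_of_complex_root[OF z False] by (auto elim: dvdE)
      have pos: "poly [:(cmod z)\<^sup>2, - 2 * Re z, 1:] y > 0" for y
      proof -
        have "poly [:(cmod z)\<^sup>2, - 2 * Re z, 1:] y = (y - Re z)\<^sup>2 + (Im z)\<^sup>2"
          using cmod_power2[of z] by (simp add: power2_eq_square algebra_simps)
        then show ?thesis using False by (simp add: add_nonneg_pos)
      qed
      show ?thesis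
        using pos by (intro step[OF e', where k = "[:\<beta>, \<alpha>, 1:]"])
          (auto simp: pcompose_pCons a2 \<beta>_def power2_eq_square algebra_simps)
    qed
  qed
qed

text \<open>For large y the leading coefficient decides; on the remaining compact interval e has a
  positive minimum.\<close>

lemma positive_poly_minus_small:
  fixes e q :: "real poly"
  assumes pos: "\<And>y. y \<ge> 0 \<Longrightarrow> poly e y > 0" and "degree q \<le> degree e" "e \<noteq> 0"
  shows "\<exists>\<epsilon>>0. \<forall>y\<ge>0. poly (e - smult \<epsilon> q) y > 0"
proof -
  have lc: "lead_coeff e > 0"
  proof (rule ccontr)
    assume "\<not> lead_coeff e > 0"
    then have "lead_coeff (- e) > 0" using \<open>e \<noteq> 0\<close> by (simp add: less_le)
    then obtain n where "\<forall>x\<ge>n. poly (- e) x \<ge> lead_coeff (- e)"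
      using poly_pinfty_gt_lc by blast
    then have "poly (- e) (max n 0) > 0" using \<open>lead_coeff (- e) > 0\<close>
      by (meson less_le_trans max.cobounded1)
    then show False using pos[of "max n 0"] by simp
  qed
  \<comment> \<open>Makes c times the coefficient of q at \<open>degree e\<close> at most half the
    leading coefficient of e, so subtracting c q preserves the degree and the sign at
    infinity.\<close>
  define c where "c = lead_coeff e / (2 * (1 + \<bar>coeff q (degree e)\<bar>))"
  have c: "c > 0" using lc by (simp add: c_def add_pos_nonneg)
  have "c * coeff q (degree e) \<le> c * (1 + \<bar>coeff q (degree e)\<bar>)"
    using c by (intro mult_left_mono) auto
  also have "\<dots> = lead_coeff e / 2"
    by (simp add: c_def field_simps)
  finally have cf: "coeff (e - smult c q) (degree e) > 0" using lc by simp
  moreover have "degree (e - smult c q) \<le> degree e"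
    using assms(2) by (intro degree_diff_le) (auto intro: order_trans[OF degree_smult_le])
  ultimately have "degree (e - smult c q) = degree e"
    by (metis le_degree antisym less_irrefl)
  then obtain R where R: "\<And>x. x \<ge> R \<Longrightarrow> poly (e - smult c q) x > 0"
    using poly_pinfty_gt_lc[of "e - smult c q"] cf by (metis less_le_trans)
  have "\<exists>x\<in>{0..max R 0}. \<forall>y\<in>{0..max R 0}. poly e x \<le> poly e y"
    by (intro continuous_attains_inf) (auto intro!: continuous_intros)
  then obtain m where m: "m > 0" "\<And>y. y \<in> {0..max R 0} \<Longrightarrow> m \<le> poly e y"
    using pos by (metis atLeastAtMost_iff)
  have "\<exists>x\<in>{0..max R 0}. \<forall>y\<in>{0..max R 0}. poly q y \<le> poly q x"
    by (intro continuous_attains_sup) (auto intro!: continuous_intros)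
  then obtain K0 where "\<And>y. y \<in> {0..max R 0} \<Longrightarrow> poly q y \<le> K0" by blast
  then obtain K where K: "K > 0" "\<And>y. y \<in> {0..max R 0} \<Longrightarrow> poly q y \<le> K"
    by (metis max.strict_coboundedI2 max.coboundedI1 zero_less_one)
  define \<epsilon> where "\<epsilon> = min c (m / (2 * K))"
  have e: "\<epsilon> > 0" "\<epsilon> \<le> c" "\<epsilon> * K < m"
  proof -
    have "\<epsilon> * K \<le> m / (2 * K) * K" using K(1) by (intro mult_right_mono) (auto simp: \<epsilon>_def)
    also have "\<dots> < m" using K(1) m(1) by simp
    finally show "\<epsilon> * K < m" .
  qed (use c m(1) K(1) in \<open>auto simp: \<epsilon>_def\<close>)
  have "poly (e - smult \<epsilon> q) y > 0" if y: "y \<ge> 0" for y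
  proof (cases "y \<le> max R 0")
    case True
    then have "\<epsilon> * poly q y \<le> \<epsilon> * K" using K(2)[of y] y e(1) by (intro mult_left_mono) auto
    then show ?thesis using m(2)[of y] y True e(3) by simp
  next
    case False
    then have "poly (e - smult c q) y > 0" using R[of y] by simp
    \<comment> \<open>c (e - \<epsilon> q) is a nonnegative combination of e and e - c q, so
      positivity at c passes to the smaller \<epsilon>.\<close>
    then have "(c - \<epsilon>) * poly e y + \<epsilon> * poly (e - smult c q) y > 0"
      using e(1,2) pos[OF y] by (intro add_nonneg_pos mult_pos_pos mult_nonneg_nonneg) auto
    also have "(c - \<epsilon>) * poly e y + \<epsilon> * poly (e - smult c q) y = c * poly (e - smult \<epsilon> q) y"
      by (simp add: algebra_simps)
    finally show ?thesis using c by (simp add: zero_less_mult_iff)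
  qed
  then show ?thesis using e(1) by blast
qed

section \<open>Cyclic vectors\<close>

lemma dot_eq_0_of_span:
  fixes x :: "'a::euclidean_space"
  assumes "span S = UNIV" and "\<And>y. y \<in> S \<Longrightarrow> x \<bullet> y = 0"
  shows "x = 0"
proof -
  have "x \<in> span S" using assms(1) by simp
  then have "orthogonal x x"
    by (rule orthogonal_to_span) (use assms(2) in \<open>auto simp: orthogonal_def\<close>)
  then show ?thesis by (simp add: orthogonal_def)
qed

text \<open>v is a cyclic vector of M, and a0 is the last member of the basis dual to v, M v, ...,
  M^(n-1) v.\<close>

locale cyclic_pair =
  fixes M :: "real^'n::finite^'n" and v a0 :: "real^'n"
  assumes dual: "k < CARD('n) \<Longrightarrow> a0 \<bullet> (mpow M k *v v) = (if Suc k = CARD('n) then 1 else 0)"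
    and spanning: "span {mpow M k *v v | k. k < CARD('n)} = UNIV"
begin

text \<open>Every row vector is $a_0^T p(M)$ for a unique $p$ of degree less than $n$, and
  duality of $a_0$ makes its product with $v$ the coefficient of $p$ at $n - 1$.\<close>

definition \<phi> :: "real poly \<Rightarrow> real^'n" where "\<phi> p = polyv p (transpose M) a0"

lemma phi_add: "\<phi> (p + q) = \<phi> p + \<phi> q"
  and phi_diff: "\<phi> (p - q) = \<phi> p - \<phi> q"
  and phi_smult: "\<phi> (smult c p) = c *\<^sub>R \<phi> p"
  and phi_0 [simp]: "\<phi> 0 = 0"
  and phi_mult: "\<phi> (p * q) = polyv p (transpose M) (\<phi> q)"
  by (simp_all add: \<phi>_def polyv_add polyv_diff polyv_smult polyv_mult scalar_mult_eq_scaleR)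

lemma phi_sum: "finite S \<Longrightarrow> \<phi> (\<Sum>k\<in>S. f k) = (\<Sum>k\<in>S. \<phi> (f k))"
  by (induction rule: finite_induct) (auto simp: phi_add)

lemma phi_shift: "\<phi> (pCons 0 p) = transpose M *v \<phi> p"
  by (simp add: \<phi>_def)

lemma phi_dot_power: "\<phi> p \<bullet> (mpow M k *v v) = \<phi> (monom 1 k * p) \<bullet> v"
proof -
  have "((*v) M ^^ k) v = polyv (monom 1 k) M v" by (simp add: polyv_monom)
  then show ?thesis by (simp add: phi_mult mpow_iterate inner_polyv_transpose)
qed

lemma phi_dot_v:
  assumes "degree p < CARD('n)"
  shows "\<phi> p \<bullet> v = coeff p (CARD('n) - 1)"
proof -
  have m: "\<phi> (monom c k) \<bullet> v = c * (if Suc k = CARD('n) then 1 else 0)" if "k < CARD('n)" for k c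
  proof -
    have "\<phi> (monom c k) \<bullet> v = c * (polyv (monom 1 k) (transpose M) a0 \<bullet> v)"
      by (simp add: \<phi>_def polyv_monom scalar_mult_eq_scaleR)
    also have "polyv (monom 1 k) (transpose M) a0 \<bullet> v = a0 \<bullet> (mpow M k *v v)"
      using inner_polyv_transpose[of a0 "monom 1 k" M v] by (simp add: polyv_monom mpow_iterate)
    finally show ?thesis by (simp add: dual[OF that])
  qed
  have "\<phi> p \<bullet> v = (\<Sum>k\<le>degree p. \<phi> (monom (coeff p k) k) \<bullet> v)"
    by (subst poly_as_sum_of_monoms[symmetric]) (simp only: phi_sum finite_atMost inner_sum_left)
  also have "\<dots> = (\<Sum>k\<le>degree p. if k = CARD('n) - 1 then coeff p k else 0)"
    using assms by (intro sum.cong refl) (auto simp: m)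
  also have "\<dots> = coeff p (CARD('n) - 1)"
    by (auto simp: sum.delta coeff_eq_0)
  finally show ?thesis .
qed

lemma phi_nonzero:
  assumes "degree p < CARD('n)" "p \<noteq> 0"
  shows "\<phi> p \<noteq> 0"
proof
  assume 0: "\<phi> p = 0"
  \<comment> \<open>Multiplying p by s^k raises its degree to exactly n - 1, where pairing with v
    reads off the leading coefficient.\<close>
  define k where "k = CARD('n) - 1 - degree p"
  have k: "k + degree p = CARD('n) - 1" using assms(1) by (simp add: k_def)
  have "degree (monom 1 k * p) = k + degree p"
    using assms(2) by (simp add: degree_mult_eq degree_monom_eq monom_eq_0_iff)
  then have "\<phi> (monom 1 k * p) \<bullet> v = coeff (monom 1 k * p) (k + degree p)"
    using phi_dot_v[of "monom 1 k * p"] k assms(1) by simp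
  then have "lead_coeff p = \<phi> p \<bullet> (mpow M k *v v)"
    by (simp add: phi_dot_power coeff_monom_mult)
  then show False using 0 assms(2) by simp
qed

text \<open>A vector is determined by its pairings with v, M v, ..., and these are matched one at a
  time. The system is triangular: the monomial of degree n - 1 - j pairs to zero with M^i v for i <
  j and to its coefficient for i = j.\<close>

lemma phi_surj:
  obtains p where "degree p < CARD('n)" "\<phi> p = x"
proof -
  have "\<exists>p. degree p < CARD('n) \<and> (\<forall>i<j. \<phi> p \<bullet> (mpow M i *v v) = x \<bullet> (mpow M i *v v))"
    if "j \<le> CARD('n)" for j
    using that
  proof (induction j)
    case 0
    then show ?case by (intro exI[of _ 0]) simp
  next
    case (Suc j)
    then obtain p where p: "degree p < CARD('n)"
      "\<And>i. i < j \<Longrightarrow> \<phi> p \<bullet> (mpow M i *v v) = x \<bullet> (mpow M i *v v)" by auto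
    define m where "m = CARD('n) - 1 - j"
    define c where "c = (x - \<phi> p) \<bullet> (mpow M j *v v)"
    have m: "\<phi> (monom c m) \<bullet> (mpow M i *v v) = (if i = j then c else 0)" if "i \<le> j" for i
    proof -
      have "\<phi> (monom c m) \<bullet> (mpow M i *v v) = \<phi> (monom c (i + m)) \<bullet> v"
        by (simp add: phi_dot_power mult_monom)
      also have "\<dots> = coeff (monom c (i + m)) (CARD('n) - 1)"
        using that Suc.prems
        by (intro phi_dot_v le_less_trans[OF degree_monom_le]) (auto simp: m_def)
      finally show ?thesis using that Suc.prems by (auto simp: m_def)
    qed
    have "degree (p + monom c m) < CARD('n)"
      using p(1) Suc.prems
      by (intro degree_add_less le_less_trans[OF degree_monom_le]) (auto simp: m_def)
    moreover have "\<phi> (p + monom c m) \<bullet> (mpow M i *v v) = x \<bullet> (mpow M i *v v)" if "i < Suc j" for i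
      using m[of i] that p(2)[of i] by (cases "i = j") (auto simp: phi_add inner_add_left c_def inner_diff_left)
    ultimately show ?case by blast
  qed
  then obtain p where p: "degree p < CARD('n)"
    "\<And>i. i < CARD('n) \<Longrightarrow> \<phi> p \<bullet> (mpow M i *v v) = x \<bullet> (mpow M i *v v)" by blast
  have "\<phi> p - x = 0"
    by (rule dot_eq_0_of_span[OF spanning]) (auto simp: inner_diff_left p(2))
  then show ?thesis using p(1) that by simp
qed

text \<open>p(M^T) commutes with every q(M^T), and the vectors q(M^T) a0 exhaust the space, so
  killing a0 is killing everything.\<close>

lemma phi_zero_annihilates:
  assumes "\<phi> p = 0"
  shows "polyv p M x = 0"
proof -
  have "y \<bullet> polyv p M x = 0" for y
  proof -
    obtain q where q: "\<phi> q = y" using phi_surj by blast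
    have "polyv p (transpose M) y = \<phi> (p * q)" by (simp add: phi_mult q)
    also have "\<dots> = \<phi> (q * p)" by (simp add: mult.commute)
    also have "\<dots> = 0" by (simp add: phi_mult assms)
    finally show ?thesis by (simp add: inner_polyv_transpose)
  qed
  then show ?thesis by (metis inner_eq_zero_iff)
qed

text \<open>Take s^n minus the representative of its image of degree below n. As
  \<open>\<phi>\<close> has no kernel below degree n, this is the minimal polynomial of M up to a
  scalar.\<close>

lemma annihilating_poly:
  obtains p where "degree p = CARD('n)" "\<phi> p = 0"
proof -
  obtain q where q: "degree q < CARD('n)" "\<phi> q = \<phi> (monom 1 (CARD('n)))" using phi_surj by blast
  have "degree (monom 1 (CARD('n)) - q) = CARD('n)"
    using q(1) by (metis degree_monom_eq zero_neq_one degree_add_eq_left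
        diff_conv_add_uminus degree_minus)
  then show ?thesis using that[of "monom 1 (CARD('n)) - q"] q(2) by (simp add: phi_diff)
qed

text \<open>With p = (s - \<mu>) q, the vector r = q(M^T) a0 satisfies (M^T - \<mu>) r = p(M^T) a0 =
  0, and it is nonzero because q has degree n - 1.\<close>

lemma annihilator_root_eigenvector:
  assumes "\<phi> p = 0" "degree p = CARD('n)" and root: "poly (map_poly complex_of_real p) \<mu> = 0"
  shows "\<exists>r. r \<noteq> 0 \<and> cmat (transpose M) *v r = \<mu> *s r"
proof -
  let ?pc = "map_poly complex_of_real p" and ?T = "cmat (transpose M)"
  obtain q where q: "?pc = [:- \<mu>, 1:] * q" using root by (auto simp: poly_eq_0_iff_dvd elim: dvdE)
  have p0: "p \<noteq> 0" using assms(2) by auto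
  have dp: "degree ?pc = CARD('n)" by (simp add: degree_map_poly assms(2))
  have q0: "q \<noteq> 0" using q dp by auto
  have dq: "Suc (degree q) = CARD('n)"
    using dp q0 unfolding q by (subst (asm) degree_mult_eq) auto
  have "coeff ?pc (Suc (degree q)) = lead_coeff q"
    unfolding q by (simp add: coeff_eq_0)
  \<comment> \<open>q shares its leading coefficient with the real polynomial p, so the real parts
    of its coefficients still form a nonzero polynomial of degree below n.\<close>
  then have lq: "lead_coeff q = complex_of_real (lead_coeff p)"
    by (simp add: dq assms(2) coeff_map_poly)
  define r where "r = polyv q ?T (cvec a0)"
  have "?T *v r - \<mu> *s r = polyv ?pc ?T (cvec a0)"
    unfolding q r_def by (simp add: polyv_mult polyv_add polyv_smult del: mult_pCons_left) 
  also have "\<dots> = cvec (\<phi> p)" by (simp add: cvec_polyv \<phi>_def)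
  also have "\<dots> = 0" by (simp add: assms(1) cvec_def vec_eq_iff)
  finally have "?T *v r = \<mu> *s r" by simp
  moreover have "r \<noteq> 0"
  proof
    assume "r = 0"
    then have "\<phi> (map_poly Re q) = 0"
      unfolding \<phi>_def Re_polyv[symmetric] by (simp add: r_def vec_eq_iff)
    moreover have "degree (map_poly Re q) < CARD('n)"
      using map_poly_degree_leq[of Re q] dq by simp
    moreover have "coeff (map_poly Re q) (degree q) \<noteq> 0"
      using lq p0 by (simp add: coeff_map_poly)
    then have "map_poly Re q \<noteq> 0" by auto
    ultimately show False using phi_nonzero by blast
  qed
  ultimately show ?thesis by blast
qed

end

section \<open>The dual cone\<close>

text \<open>The form at x + t Z x is 2 t |Z x|^2 + t^2 q, which is negative for small negative t
  unless Z x = 0.\<close>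

lemma psd_null_vector:
  fixes Z :: "real^'n^'n"
  assumes sym: "\<And>x y. x \<bullet> (Z *v y) = y \<bullet> (Z *v x)" and psd: "\<And>x. x \<bullet> (Z *v x) \<ge> 0"
    and "x \<bullet> (Z *v x) = 0"
  shows "Z *v x = 0"
proof -
  define q where "q = (Z *v x) \<bullet> (Z *v (Z *v x))"
  define b where "b = (Z *v x) \<bullet> (Z *v x)"
  have "0 \<le> 2 * t * b + t\<^sup>2 * q" for t
  proof -
    have "0 \<le> (x + t *\<^sub>R (Z *v x)) \<bullet> (Z *v (x + t *\<^sub>R (Z *v x)))" by (rule psd)
    also have "\<dots> = 2 * t * b + t\<^sup>2 * q"
      using sym[of x "Z *v x"] assms(3)
      by (simp add: matrix_vector_right_distrib matrix_vector_mult_scaleR inner_add q_def b_def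
          power2_eq_square algebra_simps inner_commute)
    finally show ?thesis .
  qed
  note nonneg = this
  have q: "q \<ge> 0" unfolding q_def by (rule psd)
  \<comment> \<open>The minimum of the parabola lies at - b / q; the denominator q + 1 also covers q
    = 0.\<close>
  define t where "t = - b / (q + 1)"
  have t: "t * (q + 1) = - b" using q by (simp add: t_def)
  have "0 \<le> (2 * t * b + t\<^sup>2 * q) * (q + 1)\<^sup>2"
    using nonneg[of t] by simp
  also have "\<dots> = 2 * (t * (q + 1)) * b * (q + 1) + (t * (q + 1))\<^sup>2 * q"
    by (simp add: power2_eq_square algebra_simps)
  also have "\<dots> = - (b\<^sup>2 * (q + 2))"
    unfolding t by (simp add: power2_eq_square algebra_simps)
  finally have "b\<^sup>2 * (q + 2) \<le> 0" by simp
  then have "b = 0" using q by (simp add: mult_le_0_iff)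
  then show ?thesis by (simp add: b_def)
qed

context cyclic_pair
begin

text \<open>With N = M - (M v) h^T, hypothesis \<open>no_neg\<close> says that (M N)^T has no
  negative eigenvalue. The polynomial \<kappa> = s \<omega> - d annihilates M and has degree n. At s
  = i sqrt y, e(y) equals 2 Re (d cnj \<omega>). If this vanishes for some y > 0, then d / \<kappa>
  is real at s, so some d + l \<kappa> is divisible by s^2 + y, and the quotient represents an
  eigenvector of (M N)^T for -y.\<close>

lemma frequency_condition:
  fixes d \<omega> :: "real poly"
  assumes w: "transpose M *v w = h" and hv: "h \<bullet> v = 1" and wv: "w \<bullet> v \<noteq> 0"
    and stable: "\<And>\<mu> r. r \<noteq> 0 \<Longrightarrow> cmat (transpose M) *v r = \<mu> *s r \<Longrightarrow> Re \<mu> < 0"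
    and no_neg: "\<And>y r. y > 0 \<Longrightarrow> r \<noteq> 0 \<Longrightarrow>
      transpose M *v (transpose M *v r) - ((M *v v) \<bullet> (transpose M *v r)) *\<^sub>R h \<noteq> - y *\<^sub>R r"
    and simple: "\<And>u. transpose M *v u = w \<Longrightarrow> u \<bullet> v \<noteq> 0"
    and d: "degree d < CARD('n)" "\<phi> d = h" and \<omega>: "degree \<omega> < CARD('n)" "\<phi> \<omega> = w"
    and e: "d * reflect \<omega> + reflect (d * reflect \<omega>) = e \<circ>\<^sub>p [:0, 0, -1:]"
    and y: "y \<ge> 0"
  shows "poly e y \<noteq> 0"
proof
  assume root: "poly e y = 0"
  define \<kappa> where "\<kappa> = pCons 0 \<omega> - d"
  have phichi: "\<phi> \<kappa> = 0" by (simp add: \<kappa>_def phi_diff phi_shift d \<omega> w)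
  have lead\<omega>: "coeff \<omega> (CARD('n) - 1) = w \<bullet> v" and leadd: "coeff d (CARD('n) - 1) = 1"
    using phi_dot_v[OF \<omega>(1)] phi_dot_v[OF d(1)] by (simp_all add: \<omega> d hv)
  have "coeff \<kappa> (CARD('n)) = w \<bullet> v"
    using lead\<omega> d(1) by (cases "CARD('n)") (auto simp: \<kappa>_def coeff_pCons coeff_eq_0)
  moreover have "degree \<kappa> \<le> CARD('n)"
    unfolding \<kappa>_def using d(1) \<omega>(1)
    by (intro degree_diff_le) (auto simp: Suc_leI intro: order_trans[OF degree_pCons_le])
  ultimately have deg\<kappa>: "degree \<kappa> = CARD('n)" using wv by (metis le_antisym le_degree)
  show False
  proof (cases "y = 0")
    case True
    have "poly (d * reflect \<omega> + reflect (d * reflect \<omega>)) 0 = poly e 0"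
      unfolding e by (simp add: poly_pcompose)
    \<comment> \<open>At s = 0 the sum is 2 d(0) \<omega>(0). If d(0) = 0, then \<kappa>(0) = 0 and
      M^T has eigenvalue 0. If \<omega> = s \<rho>, then \<rho> represents a preimage of w
      orthogonal to v.\<close>
    then have "poly d 0 * poly \<omega> 0 = 0" using root True by (auto simp: poly_pcompose)
    then consider "poly d 0 = 0" | "poly \<omega> 0 = 0" by auto
    then show False
    proof cases
      case 1
      then have "poly (map_poly complex_of_real \<kappa>) 0 = 0"
        using poly_complex_of_real_poly[of \<kappa> 0] by (simp add: \<kappa>_def)
      then show False
        using annihilator_root_eigenvector[OF phichi deg\<kappa>] stable by fastforce
    next
      case 2
      then obtain \<rho> where \<rho>: "\<omega> = pCons 0 \<rho>" by (cases \<omega>) auto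
      have "\<rho> \<noteq> 0" using lead\<omega> wv \<rho> by auto
      then have "degree \<rho> < CARD('n) - 1" using \<omega>(1) by (simp add: \<rho>)
      then have "\<phi> \<rho> \<bullet> v = 0" by (simp add: phi_dot_v coeff_eq_0)
      moreover have "transpose M *v \<phi> \<rho> = w" using \<omega>(2) by (simp add: \<rho> phi_shift)
      ultimately show False using simple by blast
    qed
  next
    case False
    define \<theta> where "\<theta> = sqrt y"
    have \<theta>: "\<theta> > 0" "\<theta>\<^sup>2 = y" using y False by (auto simp: \<theta>_def)
    define z where "z = \<i> * complex_of_real \<theta>"
    define ev where "ev p = poly (map_poly complex_of_real p) z" for p
    have ev_mult: "ev (p * q) = ev p * ev q" and ev_add: "ev (p + q) = ev p + ev q"
      and ev_smult: "ev (smult c p) = complex_of_real c * ev p" for p q c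
      by (simp_all add: ev_def map_poly_complex_of_real_mult map_poly_complex_of_real_add
          map_poly_complex_of_real_smult)
    have ev_comp: "poly (map_poly complex_of_real (p \<circ>\<^sub>p q)) x
        = poly (map_poly complex_of_real p) (poly (map_poly complex_of_real q) x)" for p q x
      by (induction p) (auto simp: pcompose_pCons map_poly_complex_of_real_add
          map_poly_complex_of_real_mult map_poly_pCons)
    have ev_reflect: "ev (reflect p) = cnj (ev p)" for p
      unfolding ev_def ev_comp using poly_map_complex_of_real_cnj[of p z]
      by (simp add: map_poly_pCons z_def)
    have "ev (e \<circ>\<^sub>p [:0, 0, -1:]) = complex_of_real (poly e y)"
      unfolding ev_def ev_comp using \<theta>(2) poly_complex_of_real_poly[of e y]
      by (simp add: map_poly_pCons z_def power2_eq_square mult_ac flip: of_real_mult)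
    then have "ev d * cnj (ev \<omega>) + cnj (ev d * cnj (ev \<omega>)) = 0"
      using root by (simp add: ev_mult ev_add ev_reflect flip: e)
    then have re: "Re (ev d * cnj (ev \<omega>)) = 0" by (simp add: complex_eq_iff algebra_simps)
    have "z * ev \<omega> = ev \<kappa> + ev d"
    proof -
      have "pCons 0 \<omega> = \<kappa> + d" by (simp add: \<kappa>_def)
      from arg_cong[OF this, of ev] show ?thesis unfolding ev_add by (simp add: ev_def map_poly_pCons)
    qed
    then have ev\<kappa>: "ev \<kappa> = z * ev \<omega> - ev d" by simp
    have "ev \<kappa> \<noteq> 0"
    proof
      assume "ev \<kappa> = 0"
      then obtain r where "r \<noteq> 0" "cmat (transpose M) *v r = z *s r"
        using annihilator_root_eigenvector[OF phichi deg\<kappa>] by (auto simp: ev_def)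
      then have "Re z < 0" by (rule stable)
      then show False by (simp add: z_def)
    qed
    \<comment> \<open>d cnj \<kappa> = cnj z (d cnj \<omega>) - |d|^2, where cnj z and d cnj
      \<omega> are both purely imaginary.\<close>
    have im: "Im (ev d * cnj (ev \<kappa>)) = 0"
      using re by (simp add: ev\<kappa> z_def algebra_simps)
    define l where "l = - Re (ev d / ev \<kappa>)"
    have "ev d / ev \<kappa> = complex_of_real (- l)"
      using im \<open>ev \<kappa> \<noteq> 0\<close> by (simp add: complex_eq_iff l_def Im_divide algebra_simps)
    then have "ev (d + smult l \<kappa>) = 0"
      using \<open>ev \<kappa> \<noteq> 0\<close> by (simp add: ev_add ev_smult field_simps)
    then have "[:(cmod z)\<^sup>2, - 2 * Re z, 1:] dvd d + smult l \<kappa>"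
      using \<theta>(1) by (intro real_quadratic_dvd_of_complex_root) (auto simp: ev_def z_def)
    moreover have "[:(cmod z)\<^sup>2, - 2 * Re z, 1:] = [:y, 0, 1:]"
      using \<theta> by (simp add: z_def norm_mult)
    ultimately obtain \<rho> where \<rho>: "d + smult l \<kappa> = [:y, 0, 1:] * \<rho>" by (auto elim: dvdE)
    have nz: "d + smult l \<kappa> \<noteq> 0"
    proof
      assume 0: "d + smult l \<kappa> = 0"
      then have "coeff (d + smult l \<kappa>) (CARD('n)) = 0" by simp
      then have "l = 0" using d(1) deg\<kappa> wv \<open>coeff \<kappa> (CARD('n)) = w \<bullet> v\<close> by (simp add: coeff_eq_0)
      then show False using 0 leadd by auto
    qed
    then have \<rho>0: "\<rho> \<noteq> 0" using \<rho> by auto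
    have "degree (d + smult l \<kappa>) \<le> CARD('n)"
      using d(1) deg\<kappa> by (intro degree_add_le) (auto intro: order_trans[OF degree_smult_le])
    moreover have "degree ([:y, 0, 1:] * \<rho>) = 2 + degree \<rho>"
      using \<rho>0 by (subst degree_mult_eq) auto
    ultimately have deg\<rho>: "degree \<rho> + 2 \<le> CARD('n)" using \<rho> by simp
    then have rv: "\<phi> \<rho> \<bullet> v = 0" by (simp add: phi_dot_v coeff_eq_0)
    have r0: "\<phi> \<rho> \<noteq> 0" using deg\<rho> \<rho>0 by (intro phi_nonzero) auto
    have "\<phi> ([:y, 0, 1:] * \<rho>) = h"
      unfolding \<rho>[symmetric] by (simp add: phi_add phi_smult phichi d)
    then have TT: "transpose M *v (transpose M *v \<phi> \<rho>) = h - y *\<^sub>R \<phi> \<rho>"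
      by (simp add: phi_add phi_smult phi_shift algebra_simps)
    \<comment> \<open>The quotient has degree at most n - 2, so its vector is orthogonal to v;
      pairing the preceding equation with v leaves h . v = 1.\<close>
    have "(M *v v) \<bullet> (transpose M *v \<phi> \<rho>) = 1"
      using TT inner_transpose_vector[of "transpose M *v \<phi> \<rho>" M v] hv rv
      by (simp add: inner_diff_left inner_diff_right inner_commute)
    then show False
      using no_neg[of y "\<phi> \<rho>"] y False r0 TT by (simp)
  qed
qed

end

section \<open>The dual matrix as a moment functional\<close>

lemma minus_one_power_cancel: "t \<le> j \<Longrightarrow> (-1::real) ^ t * (-1) ^ (j - t) = (-1) ^ j"
  by (simp flip: power_add)

context cyclic_pair
begin

text \<open>In the basis b_i = \<open>\<phi>\<close> (s^i), moving a factor M^T from one argument to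
  the other changes the sign, so the Gram matrix of Z is Hankel up to the signs (-1)^j. Its
  antidiagonal values are the moments of L, and symmetry of Z kills the odd ones.\<close>

lemma bilinear_form_moments:
  fixes Z :: "real^'n^'n"
  assumes sym: "\<And>x y. x \<bullet> (Z *v y) = y \<bullet> (Z *v x)"
    and skew: "\<And>a b. a \<bullet> v = 0 \<Longrightarrow> b \<bullet> v = 0 \<Longrightarrow>
      a \<bullet> (Z *v (transpose M *v b)) + b \<bullet> (Z *v (transpose M *v a)) = 0"
  obtains L :: "real poly \<Rightarrow> real"
  where "\<And>p q. L (p + q) = L p + L q" and "\<And>c p. L (smult c p) = c * L p"
    and "\<And>p q. degree p < CARD('n) \<Longrightarrow> degree q < CARD('n) \<Longrightarrow>
      L (p * reflect q) = \<phi> p \<bullet> (Z *v \<phi> q)"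
    and "\<And>p q. degree p < CARD('n) \<Longrightarrow> degree q < CARD('n) \<Longrightarrow>
      L (reflect (p * reflect q)) = \<phi> p \<bullet> (Z *v \<phi> q)"
proof -
  define n where "n = CARD('n)"
  have n0: "n > 0" by (simp add: n_def)
  define b where "b i = \<phi> (monom 1 i)" for i
  define B where "B i j = b i \<bullet> (Z *v b j)" for i j
  have Bsym: "B i j = B j i" for i j unfolding B_def by (rule sym)
  have bSuc: "b (Suc i) = transpose M *v b i" for i
    by (simp add: b_def monom_Suc phi_shift)
  have bv: "b i \<bullet> v = 0" if "Suc i < n" for i
    using that unfolding b_def
    by (subst phi_dot_v) (auto simp: n_def degree_monom_eq)
  have B1: "B i (Suc j) = - B (Suc i) j" if "Suc i < n" "Suc j < n" for i j
    using skew[OF bv[OF that(1)] bv[OF that(2)]] Bsym[of "Suc i" j]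
    by (simp add: B_def bSuc)
  have Bt: "B i j = (-1) ^ t * B (i + t) (j - t)" if "t \<le> j" "i + t < n" "j < n" for i j t
    using that
  proof (induction t)
    case (Suc t)
    then have "B i j = (-1) ^ t * B (i + t) (Suc (j - Suc t))"
      by (simp add: Suc_diff_Suc)
    also have "B (i + t) (Suc (j - Suc t)) = - B (Suc (i + t)) (j - Suc t)"
      using Suc.prems by (intro B1) auto
    finally show ?case by simp
  qed simp
  \<comment> \<open>For k \<le> 2 (n - 1) the antidiagonal i + j = k is sampled at its largest row
    index, and the sign undoes the factor (-1)^j.\<close>
  define m where "m k = (-1) ^ (k - min k (n - 1)) * B (min k (n - 1)) (k - min k (n - 1))" for k
  have Bm: "B i j = (-1) ^ j * m (i + j)" if "i < n" "j < n" for i j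
  proof -
    define t where "t = min (i + j) (n - 1) - i"
    have t: "t \<le> j" "i + t = min (i + j) (n - 1)" "j - t = i + j - min (i + j) (n - 1)" "i + t < n"
      using that by (auto simp: t_def)
    have "B i j = (-1) ^ t * B (i + t) (j - t)" using t that by (intro Bt) auto
    also have "\<dots> = (-1) ^ t * ((-1) ^ (j - t) * m (i + j))"
      unfolding m_def by (simp add: t(2,3) flip: mult.assoc power_mult_distrib)
    finally show ?thesis using minus_one_power_cancel[OF t(1)] by (simp flip: mult.assoc)
  qed
  \<comment> \<open>For odd k the signs (-1)^i and (-1)^j differ while B i j = B j i.\<close>
  have modd: "m k = 0" if "odd k" "k \<le> 2 * (n - 1)" for k
  proof -
    define i j where "i = min k (n - 1)" and "j = k - i"
    have ij: "i + j = k" "i < n" "j < n" using that n0 by (auto simp: i_def j_def)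
    have "(-1) ^ j * m k = (-1) ^ i * m k"
      using Bm[of i j] Bm[of j i] ij Bsym[of i j] by (auto simp: add.commute)
    then show ?thesis using that(1) ij(1) by (cases "even i") auto
  qed
  define L where "L p = (\<Sum>k<2 * n. coeff p k * m k)" for p
  have add: "L (p + q) = L p + L q" and smult: "L (smult c p) = c * L p" for p q c
    by (simp_all add: L_def sum.distrib sum_distrib_left algebra_simps)
  have L0: "L 0 = 0" by (simp add: L_def)
  have Lsum: "L (\<Sum>k\<in>S. f k) = (\<Sum>k\<in>S. L (f k))" if "finite S" for S :: "nat set" and f
    using that by (induction rule: finite_induct) (auto simp: add L0)
  have Lmonom: "L (monom c k) = c * m k" if "k < 2 * n" for c k
  proof -
    have "L (monom c k) = (\<Sum>j<2 * n. if j = k then c * m k else 0)"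
      unfolding L_def by (intro sum.cong) auto
    then show ?thesis using that by simp
  qed
  have expand: "p = (\<Sum>k<n. monom (coeff p k) k)" if "degree p < n" for p
    using poly_as_sum_of_monoms'[of p "n - 1"] that n0
    by (simp add: lessThan_Suc_atMost[symmetric])
  have main: "L (p * reflect q) = \<phi> p \<bullet> (Z *v \<phi> q)" if p: "degree p < n" and q: "degree q < n" for p q
  proof -
    have "degree (reflect q) < n" using q by simp
    note rq = expand[OF this]
    have phi_b: "(\<Sum>i<n. coeff r i *\<^sub>R b i) = \<phi> r" if "degree r < n" for r
    proof -
      have "\<phi> r = (\<Sum>i<n. \<phi> (smult (coeff r i) (monom 1 i)))"
        by (subst expand[OF that]) (simp add: phi_sum smult_monom)
      then show ?thesis by (simp add: phi_smult b_def)
    qed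
    have "L (p * reflect q) = L (\<Sum>i<n. \<Sum>j<n. monom (coeff p i * coeff (reflect q) j) (i + j))"
      by (subst expand[OF p], subst rq) (simp add: sum_product mult_monom)
    also have "\<dots> = (\<Sum>i<n. \<Sum>j<n. coeff p i * coeff (reflect q) j * m (i + j))"
      by (simp add: Lsum Lmonom)
    also have "\<dots> = (\<Sum>i<n. \<Sum>j<n. coeff p i * coeff q j * B i j)"
      by (intro sum.cong refl) (simp add: Bm coeff_reflect)
    also have "\<dots> = (\<Sum>i<n. coeff p i *\<^sub>R b i) \<bullet> (Z *v (\<Sum>j<n. coeff q j *\<^sub>R b j))"
      by (subst sum.swap) (simp add: B_def inner_sum_left inner_sum_right matrix_vector_mult_scaleR
          linear_sum[OF matrix_vector_mul_linear] sum_distrib_left mult_ac)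
    also have "\<dots> = \<phi> p \<bullet> (Z *v \<phi> q)" by (simp only: phi_b[OF p] phi_b[OF q])
    finally show ?thesis .
  qed
  have "L (reflect (p * reflect q)) = L (p * reflect q)" if "degree p < n" "degree q < n" for p q
  proof -
    have "degree (p * reflect q) \<le> 2 * (n - 1)"
      using degree_mult_le[of p "reflect q"] that by simp
    then have "coeff (reflect (p * reflect q)) k * m k = coeff (p * reflect q) k * m k" for k
      using modd[of k] by (cases "odd k"; cases "k \<le> 2 * (n - 1)") (auto simp: coeff_reflect coeff_eq_0)
    then show ?thesis unfolding L_def by (simp only:)
  qed
  then show ?thesis using that[of L] add smult main by (simp add: n_def)
qed

text \<open>L sends e(-s^2) to 2 w^T Z h = 0. Spectral factorization of a slightly smaller positive
  polynomial turns this zero into a sum of nonnegative terms that includes every b_i^T Z b_i with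
  positive weight, so each b_i is a null vector of Z.\<close>

lemma dual_cone_trivial:
  fixes Z :: "real^'n^'n"
  assumes sym: "\<And>x y. x \<bullet> (Z *v y) = y \<bullet> (Z *v x)" and psd: "\<And>x. x \<bullet> (Z *v x) \<ge> 0"
    and skew: "\<And>a b. a \<bullet> v = 0 \<Longrightarrow> b \<bullet> v = 0 \<Longrightarrow>
      a \<bullet> (Z *v (transpose M *v b)) + b \<bullet> (Z *v (transpose M *v a)) = 0"
    and w: "transpose M *v w = h" and hv: "h \<bullet> v = 1" and wv: "w \<bullet> v \<noteq> 0"
    and wZh: "w \<bullet> (Z *v h) = 0"
    and stable: "\<And>\<mu> r. r \<noteq> 0 \<Longrightarrow> cmat (transpose M) *v r = \<mu> *s r \<Longrightarrow> Re \<mu> < 0"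
    and no_neg: "\<And>y r. y > 0 \<Longrightarrow> r \<noteq> 0 \<Longrightarrow>
      transpose M *v (transpose M *v r) - ((M *v v) \<bullet> (transpose M *v r)) *\<^sub>R h \<noteq> - y *\<^sub>R r"
    and simple: "\<And>u. transpose M *v u = w \<Longrightarrow> u \<bullet> v \<noteq> 0"
  shows "Z *v x = 0"
proof -
  obtain L where L: "\<And>p q. L (p + q) = L p + L q" "\<And>c p. L (smult c p) = c * L p"
    "\<And>p q. degree p < CARD('n) \<Longrightarrow> degree q < CARD('n) \<Longrightarrow> L (p * reflect q) = \<phi> p \<bullet> (Z *v \<phi> q)"
    "\<And>p q. degree p < CARD('n) \<Longrightarrow> degree q < CARD('n) \<Longrightarrow>
      L (reflect (p * reflect q)) = \<phi> p \<bullet> (Z *v \<phi> q)"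
    using bilinear_form_moments[OF sym skew] by blast
  obtain d where d: "degree d < CARD('n)" "\<phi> d = h" using phi_surj by blast
  obtain \<omega> where \<omega>: "degree \<omega> < CARD('n)" "\<phi> \<omega> = w" using phi_surj by blast
  let ?n = "CARD('n) - 1"
  let ?F = "d * reflect \<omega> + reflect (d * reflect \<omega>)"
  have "reflect ?F = ?F" by (simp add: pcompose_add add.commute)
  then obtain e where e: "?F = e \<circ>\<^sub>p [:0, 0, -1:]" using even_poly_as_square_composition by blast
  have nz: "poly e y \<noteq> 0" if "y \<ge> 0" for y
    by (rule frequency_condition[OF w hv wv stable no_neg simple d \<omega> e that])
  \<comment> \<open>The coefficients of d and \<omega> at n - 1 are h . v and w . v, both nonzero.
    Their product belongs to the even degree 2 (n - 1), so reflection doubles it instead of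
    cancelling it.\<close>
  have dege: "degree e = ?n"
  proof -
    have "coeff d ?n = 1" "coeff \<omega> ?n \<noteq> 0"
      using phi_dot_v[OF d(1)] phi_dot_v[OF \<omega>(1)] hv wv d(2) \<omega>(2) by auto
    moreover from this have "degree d = ?n" "degree \<omega> = ?n"
      using d(1) \<omega>(1) le_degree[of d ?n] le_degree[of \<omega> ?n] by auto
    ultimately have "coeff (d * reflect \<omega>) (2 * ?n) \<noteq> 0"
      using coeff_mult_degree_sum[of d "reflect \<omega>"] by (simp add: coeff_reflect mult_2)
    then have "coeff ?F (2 * ?n) \<noteq> 0" by (simp add: coeff_reflect)
    moreover have "degree ?F \<le> 2 * ?n"
      using degree_mult_le[of d "reflect \<omega>"] \<open>degree d = ?n\<close> \<open>degree \<omega> = ?n\<close>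
      by (intro degree_add_le) auto
    ultimately have "degree ?F = 2 * ?n" by (metis le_antisym le_degree)
    then show ?thesis unfolding e by (simp add: degree_pcompose)
  qed
  have Le: "L (e \<circ>\<^sub>p [:0, 0, -1:]) = 0"
    unfolding e[symmetric] L(1) using L(3,4)[OF d(1) \<omega>(1)] d(2) \<omega>(2) wZh sym[of h w] by simp
  \<comment> \<open>e has no zero for y \<ge> 0, so the intermediate value theorem gives it a
    constant sign there, which s normalizes.\<close>
  obtain s where s: "s \<noteq> 0" "\<And>y. y \<ge> 0 \<Longrightarrow> poly (smult s e) y > 0"
  proof (cases "poly e 0 > 0")
    case True
    have "poly e y > 0" if y: "y \<ge> 0" for y
    proof (rule ccontr)
      assume "\<not> poly e y > 0"
      then obtain x where "0 \<le> x" "poly e x = 0"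
        using IVT2'[of "poly e" y 0 0] True y continuous_on_poly[OF continuous_on_id, of "{0..y}" e] by auto
      then show False using nz by blast
    qed
    then show ?thesis using that[of 1] by simp
  next
    case False
    have "poly e y < 0" if y: "y \<ge> 0" for y
    proof (rule ccontr)
      assume "\<not> poly e y < 0"
      then obtain x where "0 \<le> x" "poly e x = 0"
        using IVT'[of "poly e" 0 0 y] False y continuous_on_poly[OF continuous_on_id, of "{0..y}" e] by auto
      then show False using nz by blast
    qed
    then show ?thesis using that[of "-1"] by simp
  qed
  \<comment> \<open>Composition with -s^2 turns y^i into s^i (-s)^i, whose value under L is b_i^T Z
    b_i.\<close>
  define S where "S = (\<Sum>i<CARD('n). monom (1::real) i)"
  have "degree S \<le> ?n" unfolding S_def
    by (intro degree_sum_le) (auto intro: order_trans[OF degree_monom_le])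
  moreover have "e \<noteq> 0" using nz[of 0] by auto
  ultimately obtain \<epsilon> where \<epsilon>: "\<epsilon> > 0" "\<And>y. y \<ge> 0 \<Longrightarrow> poly (smult s e - smult \<epsilon> S) y > 0"
    using positive_poly_minus_small[OF s(2), of S] s(1) dege by auto
  obtain k where k: "degree k = degree (smult s e - smult \<epsilon> S)"
    "(smult s e - smult \<epsilon> S) \<circ>\<^sub>p [:0, 0, -1:] = k * reflect k"
    using positive_on_nonneg_spectral_factor[OF \<epsilon>(2)] by blast
  have "degree (smult s e - smult \<epsilon> S) \<le> ?n"
    using dege \<open>degree S \<le> ?n\<close> by (intro degree_diff_le) (auto intro: order_trans[OF degree_smult_le])
  then have kn: "degree k < CARD('n)" using k(1) by (simp add: le_less_trans)
  have L0: "L 0 = 0" using L(2)[of 0 0] by simp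
  have Lsum: "L (\<Sum>k\<in>A. f k) = (\<Sum>k\<in>A. L (f k))" if "finite A" for A :: "nat set" and f
    using that by (induction rule: finite_induct) (auto simp: L(1) L0)
  have S_comp: "S \<circ>\<^sub>p [:0, 0, -1:] = (\<Sum>i<CARD('n). monom 1 i * reflect (monom 1 i))"
  proof -
    have "monom 1 i \<circ>\<^sub>p [:0, 0, -1:] = monom 1 i * reflect (monom (1::real) i)" for i
      by (induction i) (auto simp: monom_Suc monom_0 pcompose_pCons)
    then show ?thesis by (simp add: S_def pcompose_sum)
  qed
  have "s * L (e \<circ>\<^sub>p [:0, 0, -1:]) = L (k * reflect k + smult \<epsilon> (S \<circ>\<^sub>p [:0, 0, -1:]))"
    unfolding k(2)[symmetric] by (simp add: pcompose_diff pcompose_smult flip: L(2))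
  also have "\<dots> = \<phi> k \<bullet> (Z *v \<phi> k)
      + \<epsilon> * (\<Sum>i<CARD('n). \<phi> (monom 1 i) \<bullet> (Z *v \<phi> (monom 1 i)))"
    unfolding S_comp by (simp add: L Lsum kn degree_monom_eq)
  finally have "\<phi> k \<bullet> (Z *v \<phi> k)
      + \<epsilon> * (\<Sum>i<CARD('n). \<phi> (monom 1 i) \<bullet> (Z *v \<phi> (monom 1 i))) = 0"
    by (simp add: Le)
  moreover have "(\<Sum>i<CARD('n). \<phi> (monom 1 i) \<bullet> (Z *v \<phi> (monom 1 i))) \<ge> 0"
    by (intro sum_nonneg psd)
  ultimately have "(\<Sum>i<CARD('n). \<phi> (monom 1 i) \<bullet> (Z *v \<phi> (monom 1 i))) = 0"
    using psd[of "\<phi> k"] \<epsilon>(1) by (smt (verit) mult_pos_pos)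
  then have "\<phi> (monom 1 i) \<bullet> (Z *v \<phi> (monom 1 i)) = 0" if "i < CARD('n)" for i
    using that by (subst (asm) sum_nonneg_eq_0_iff) (auto simp: psd)
  then have Zb: "Z *v \<phi> (monom 1 i) = 0" if "i < CARD('n)" for i
    using that by (intro psd_null_vector[OF sym psd]) auto
  obtain p where p: "degree p < CARD('n)" "\<phi> p = x" using phi_surj by blast
  have "p = (\<Sum>i<CARD('n). smult (coeff p i) (monom 1 i))"
    using poly_as_sum_of_monoms'[of p ?n] p(1)
    by (simp add: lessThan_Suc_atMost[symmetric] smult_monom)
  then have "x = (\<Sum>i<CARD('n). coeff p i *\<^sub>R \<phi> (monom 1 i))"
    using p(2) by (metis (no_types, lifting) phi_sum phi_smult sum.cong finite_lessThan)
  then have "Z *v x = (\<Sum>i<CARD('n). coeff p i *\<^sub>R (Z *v \<phi> (monom 1 i)))"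
    by (simp add: linear_sum[OF matrix_vector_mul_linear] matrix_vector_mult_scaleR)
  also have "\<dots> = 0" by (simp add: Zb)
  finally show ?thesis .
qed

end

section \<open>Positivity of Lyapunov matrices\<close>

text \<open>Once |u| is below (\<epsilon>/2)(1 - \<rho>), the level \<epsilon>/2 is stationary for
  the bounding recursion, and the excess over it decays geometrically.\<close>

lemma perturbed_contraction_tendsto_0:
  fixes a :: "nat \<Rightarrow> 'a::real_normed_field"
  assumes rec: "\<And>k. a (Suc k) = \<mu> * a k + u k" and \<mu>: "norm \<mu> < 1" and u: "u \<longlonglongrightarrow> 0"
  shows "a \<longlonglongrightarrow> 0"
proof (rule LIMSEQ_I)
  fix \<epsilon> :: real assume "\<epsilon> > 0"
  define \<rho> where "\<rho> = norm \<mu>"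
  have \<rho>: "0 \<le> \<rho>" "\<rho> < 1" using \<mu> by (auto simp: \<rho>_def)
  have "\<epsilon> / 2 * (1 - \<rho>) > 0" using \<open>\<epsilon> > 0\<close> \<rho> by simp
  then obtain N where N: "\<And>k. k \<ge> N \<Longrightarrow> norm (u k) < \<epsilon> / 2 * (1 - \<rho>)"
    using LIMSEQ_D[OF u] by (metis diff_zero)
  have bound: "norm (a (N + j)) \<le> \<epsilon> / 2 + \<rho> ^ j * norm (a N)" for j
  proof (induction j)
    case 0
    then show ?case using \<open>\<epsilon> > 0\<close> by simp
  next
    case (Suc j)
    have "norm (a (N + Suc j)) \<le> \<rho> * norm (a (N + j)) + norm (u (N + j))"
      using norm_triangle_ineq[of "\<mu> * a (N + j)" "u (N + j)"] by (simp add: rec norm_mult \<rho>_def)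
    also have "\<dots> \<le> \<rho> * (\<epsilon> / 2 + \<rho> ^ j * norm (a N)) + \<epsilon> / 2 * (1 - \<rho>)"
      using Suc \<rho> N[of "N + j"] by (intro add_mono mult_left_mono) auto
    also have "\<dots> = \<epsilon> / 2 + \<rho> ^ Suc j * norm (a N)" by (simp add: field_simps)
    finally show ?case .
  qed
  have "(\<lambda>j. \<rho> ^ j * norm (a N)) \<longlonglongrightarrow> 0 * norm (a N)"
    using \<rho> by (intro tendsto_intros LIMSEQ_realpow_zero) auto
  then obtain J where J: "\<And>j. j \<ge> J \<Longrightarrow> norm (\<rho> ^ j * norm (a N)) < \<epsilon> / 2"
    using LIMSEQ_D[of "\<lambda>j. \<rho> ^ j * norm (a N)" 0 "\<epsilon> / 2"] \<open>\<epsilon> > 0\<close> by auto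
  have "norm (a k - 0) < \<epsilon>" if "k \<ge> N + J" for k
  proof -
    have "J \<le> k - N" using that by simp
    from bound[of "k - N"] J[OF this] that show ?thesis by (simp add: abs_if split: if_splits)
  qed
  then show "\<exists>no. \<forall>k\<ge>no. norm (a k - 0) < \<epsilon>" by blast
qed

lemma cmod_cayley_less_1:
  assumes "Re \<mu> < 0"
  shows "cmod ((1 + \<mu>) / (1 - \<mu>)) < 1"
proof -
  have "(cmod (1 + \<mu>))\<^sup>2 < (cmod (1 - \<mu>))\<^sup>2"
    using assms unfolding cmod_power2 by (simp add: power2_eq_square algebra_simps)
  then have "cmod (1 + \<mu>) < cmod (1 - \<mu>)" by (rule power2_less_imp_less) simp
  moreover have "cmod (1 - \<mu>) > 0" using calculation by (metis norm_ge_zero le_less_trans)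
  ultimately show ?thesis by (simp add: norm_divide)
qed

text \<open>The recursion iterates the Cayley transform of M, written without an inverse. Split p =
  (s - \<mu>) q: then g = q(M) f obeys the same recursion and M g - \<mu> g tends to 0, so each
  component of g is multiplied by (1 + \<mu>) / (1 - \<mu>), of modulus below 1, up to a null
  sequence.\<close>

lemma cayley_iterates_tendsto_0:
  fixes M :: "complex^'n::finite^'n"
  assumes rec: "\<And>k. f (Suc k) - M *v f (Suc k) = f k + M *v f k"
    and "p \<noteq> 0" "\<And>z. poly p z = 0 \<Longrightarrow> Re z < 0"
    and "(\<lambda>k. polyv p M (f k)) \<longlonglongrightarrow> 0"
  shows "f \<longlonglongrightarrow> 0"
  using assms(2-4)
proof (induction "degree p" arbitrary: p)
  case 0
  then obtain a where a: "p = [:a:]" "a \<noteq> 0" by (metis degree_eq_zeroE pCons_0_0)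
  have "(\<lambda>k. polyv p M (f k) $ i) \<longlonglongrightarrow> 0 $ i" for i
    by (intro tendsto_vec_nth 0)
  then have "(\<lambda>k. inverse a * (a * f k $ i)) \<longlonglongrightarrow> inverse a * 0" for i
    by (intro tendsto_mult_left) (simp add: a)
  then have "(\<lambda>k. f k $ i) \<longlonglongrightarrow> 0 $ i" for i using a(2) by (simp flip: mult.assoc)
  then show ?case by (rule vec_tendstoI)
next
  case (Suc n)
  then have "\<not> constant (poly p)" by (simp add: constant_degree)
  then obtain \<mu> where \<mu>: "poly p \<mu> = 0" using fundamental_theorem_of_algebra by blast
  then obtain q where q: "p = [:- \<mu>, 1:] * q" by (auto simp: poly_eq_0_iff_dvd elim: dvdE)
  have Re: "Re \<mu> < 0" using Suc.prems(2) \<mu> by blast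
  have q0: "q \<noteq> 0" using Suc.prems(1) q by auto
  have dq: "n = degree q" using Suc.hyps(2) q0 unfolding q by (subst (asm) degree_mult_eq) auto
  define g where "g k = polyv q M (f k)" for k
  define e where "e k = polyv p M (f k)" for k
  have e: "e k = M *v g k - \<mu> *s g k" for k
    unfolding e_def q g_def by (simp add: polyv_mult del: mult_pCons_left)
  have grec: "g (Suc k) - M *v g (Suc k) = g k + M *v g k" for k
  proof -
    have "f (Suc k) = f k + M *v f k + M *v f (Suc k)" using rec[of k] by (simp add: algebra_simps)
    from arg_cong[OF this, of "polyv q M"] show ?thesis
      unfolding g_def polyv_arg_add polyv_arg_matrix by (metis add_diff_cancel_right')
  qed
  have m1: "1 - \<mu> \<noteq> 0" using Re by auto
  have eq: "(1 - \<mu>) * g (Suc k) $ i = (1 + \<mu>) * g k $ i + (e k + e (Suc k)) $ i" for k i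
    using arg_cong[OF grec[of k], of "\<lambda>x. x $ i"] by (simp add: e algebra_simps)
  have g_rec: "g (Suc k) $ i = (1 + \<mu>) / (1 - \<mu>) * g k $ i + (e k + e (Suc k)) $ i / (1 - \<mu>)" for k i
    using eq[of k i] m1
    by (metis add_divide_distrib nonzero_mult_div_cancel_left times_divide_eq_left)
  have e0: "e \<longlonglongrightarrow> 0" using Suc.prems(3) unfolding e_def[abs_def] .
  have "(\<lambda>k. (e k + e (Suc k)) $ i / (1 - \<mu>)) \<longlonglongrightarrow> (0 + 0) $ i / (1 - \<mu>)" for i
    using m1 by (intro tendsto_intros e0 LIMSEQ_Suc)
  then have u0: "(\<lambda>k. (e k + e (Suc k)) $ i / (1 - \<mu>)) \<longlonglongrightarrow> 0" for i by simp
  have "(\<lambda>k. g k $ i) \<longlonglongrightarrow> 0" for i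
    by (rule perturbed_contraction_tendsto_0[OF g_rec cmod_cayley_less_1[OF Re] u0])
  then have "g \<longlonglongrightarrow> 0" by (intro vec_tendstoI) simp
  then show ?case
    using Suc.hyps(1)[OF dq q0] Suc.prems(2) unfolding g_def[abs_def] q by simp
qed

lemma polyv_fixed_point:
  assumes "M *v x = x"
  shows "polyv p M x = poly p 1 *s x"
  by (induction p) (auto simp: matrix_vector_mult_smult assms vector_sadd_rdistrib)

text \<open>Along the Cayley iterates of x the form never increases, drops strictly in the first
  step, and tends to 0. A nonpositive start would keep it below a negative constant.\<close>

lemma lyapunov_positive_definite:
  fixes M P :: "real^'n::finite^'n"
  assumes "p \<noteq> 0" and ann: "\<And>x. polyv p M x = 0"
    and roots: "\<And>z. poly (map_poly complex_of_real p) z = 0 \<Longrightarrow> Re z < 0"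
    and sym: "\<And>x y. x \<bullet> (P *v y) = y \<bullet> (P *v x)"
    and neg: "\<And>x. x \<noteq> 0 \<Longrightarrow> x \<bullet> (P *v (M *v x)) < 0"
    and "x \<noteq> 0"
  shows "x \<bullet> (P *v x) > 0"
proof (rule ccontr)
  assume np: "\<not> x \<bullet> (P *v x) > 0"
  \<comment> \<open>A nonzero fixed vector of M would make 1 a root of p, whose roots all lie in the
    left half-plane.\<close>
  have inj: "y = 0" if "(mat 1 - M) *v y = 0" for y
  proof (rule ccontr)
    assume "y \<noteq> 0"
    have "M *v y = y" using that by (simp add: matrix_vector_mult_diff_rdistrib)
    then have "poly p 1 *s y = 0" using ann[of y] by (simp add: polyv_fixed_point)
    then have "poly p 1 = 0" using \<open>y \<noteq> 0\<close> by simp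
    then have "Re 1 < 0" using roots[of 1] poly_complex_of_real_poly[of p 1] by simp
    then show False by simp
  qed
  then obtain R where R: "R ** (mat 1 - M) = mat 1" "(mat 1 - M) ** R = mat 1"
    by (metis matrix_left_invertible_ker matrix_left_right_inverse)
  define f where "f = rec_nat x (\<lambda>_ y. R *v (y + M *v y))"
  have f0: "f 0 = x" and fSuc: "f (Suc k) = R *v (f k + M *v f k)" for k
    by (simp_all add: f_def)
  have rec: "f (Suc k) - M *v f (Suc k) = f k + M *v f k" for k
  proof -
    have "(mat 1 - M) *v f (Suc k) = f k + M *v f k"
      unfolding fSuc matrix_vector_mul_assoc R(2) by simp
    then show ?thesis by (simp add: matrix_vector_mult_diff_rdistrib)
  qed
  have cdist: "cvec (a - b) = cvec a - cvec b" "cvec (a + b) = cvec a + cvec b" for a b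
    by (simp_all add: cvec_def vec_eq_iff)
  have "(\<lambda>k. cvec (f k)) \<longlonglongrightarrow> 0"
  proof (rule cayley_iterates_tendsto_0)
    show "cvec (f (Suc k)) - cmat M *v cvec (f (Suc k)) = cvec (f k) + cmat M *v cvec (f k)" for k
      unfolding cmat_cvec cdist[symmetric] rec ..
    show "map_poly complex_of_real p \<noteq> 0" using \<open>p \<noteq> 0\<close> by (simp add: map_poly_eq_0_iff)
    show "(\<lambda>k. polyv (map_poly complex_of_real p) (cmat M) (cvec (f k))) \<longlonglongrightarrow> 0"
      unfolding cvec_polyv ann by (simp add: cvec_def zero_vec_def)
  qed (rule roots)
  then have "(\<lambda>k. Re (cvec (f k) $ i)) \<longlonglongrightarrow> Re (0 $ i)" for i
    by (intro tendsto_Re tendsto_vec_nth)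
  then have "(\<lambda>k. f k $ i) \<longlonglongrightarrow> 0 $ i" for i by (simp add: cvec_def)
  then have "f \<longlonglongrightarrow> 0" by (rule vec_tendstoI)
  then have "(\<lambda>k. f k \<bullet> (P *v f k)) \<longlonglongrightarrow> 0 \<bullet> (P *v 0)"
    by (intro tendsto_inner bounded_linear.tendsto[OF matrix_vector_mul_bounded_linear])
  then have lim: "(\<lambda>k. f k \<bullet> (P *v f k)) \<longlonglongrightarrow> 0" by simp
  \<comment> \<open>M maps f (Suc k) + f k to f (Suc k) - f k, so the increment of the form is the
    product form x^T P M x at the sum.\<close>
  have step: "f (Suc k) \<bullet> (P *v f (Suc k)) - f k \<bullet> (P *v f k)
      = (f (Suc k) + f k) \<bullet> (P *v (M *v (f (Suc k) + f k)))" for k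
  proof -
    have "M *v (f (Suc k) + f k) = f (Suc k) - f k"
      using rec[of k] by (simp add: matrix_vector_right_distrib algebra_simps)
    then show ?thesis using sym[of "f k" "f (Suc k)"]
      by (simp add: matrix_vector_mult_diff_distrib inner_add_left inner_diff_right)
  qed
  have le: "f (Suc k) \<bullet> (P *v f (Suc k)) \<le> f k \<bullet> (P *v f k)" for k
    using step[of k] neg[of "f (Suc k) + f k"] by (cases "f (Suc k) + f k = 0") auto
  have "f (Suc 0) + f 0 \<noteq> 0"
  proof
    assume "f (Suc 0) + f 0 = 0"
    moreover have "f (Suc 0) - f 0 = M *v (f (Suc 0) + f 0)"
      using rec[of 0] by (simp add: matrix_vector_right_distrib algebra_simps)
    ultimately have "f (Suc 0) + f 0 = 0" "f (Suc 0) - f 0 = 0" by simp_all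
    then have "2 *\<^sub>R f 0 = 0" by (simp add: scaleR_2)
    then show False using f0 \<open>x \<noteq> 0\<close> by simp
  qed
  then have less: "f 1 \<bullet> (P *v f 1) < 0"
    using step[of 0] neg[of "f (Suc 0) + f 0"] np f0 by simp
  have "f k \<bullet> (P *v f k) \<le> f 1 \<bullet> (P *v f 1)" if "k \<ge> 1" for k
    using that by (induction k rule: dec_induct) (auto intro: order_trans[OF le])
  then have "0 \<le> f 1 \<bullet> (P *v f 1)"
    by (intro LIMSEQ_le_const2[OF lim]) blast
  then show False using less by simp
qed

section \<open>Separation\<close>

definition outer :: "real^'n \<Rightarrow> real^'m \<Rightarrow> real^'m^'n" where
  "outer a b = (\<chi> i j. a$i * b$j)"

lemma outer_mult_vector: "outer a b *v x = (b \<bullet> x) *\<^sub>R a"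
  by (simp add: outer_def matrix_vector_mult_def vec_eq_iff inner_vec_def sum_distrib_right
      sum_distrib_left mult_ac)

lemma transpose_outer: "transpose (outer a b) = outer b a"
  by (simp add: outer_def transpose_def vec_eq_iff mult.commute)

lemma outer_mult_matrix: "outer a b ** M = outer a (transpose M *v b)"
  by (simp add: outer_def matrix_matrix_mult_def matrix_vector_mult_def transpose_def vec_eq_iff
      sum_distrib_left mult_ac)

lemma inner_outer: "Z \<bullet> outer a b = a \<bullet> (Z *v b)"
  by (simp add: outer_def inner_vec_def matrix_vector_mult_def sum_distrib_left mult_ac)

text \<open>Separates the subspace of all P M from the convex cone of matrices with negative
  definite quadratic form. The cone contains non-symmetric matrices, and this forces the dual Z to
  be symmetric.\<close>

lemma negative_definite_product_or_dual:
  fixes M :: "real^'n::finite^'n" and W :: "(real^'n^'n) set"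
  assumes W: "subspace W"
  obtains (primal) P where "P \<in> W" "\<And>x. x \<noteq> 0 \<Longrightarrow> x \<bullet> (P *v (M *v x)) < 0"
  | (dual) Z where "Z \<noteq> 0" "\<And>x y. x \<bullet> (Z *v y) = y \<bullet> (Z *v x)" "\<And>x. x \<bullet> (Z *v x) \<ge> 0"
      "\<And>P. P \<in> W \<Longrightarrow> Z \<bullet> (P ** M) = 0"
proof (cases "\<exists>P\<in>W. \<forall>x. x \<noteq> 0 \<longrightarrow> x \<bullet> (P *v (M *v x)) < 0")
  case True
  then show ?thesis using primal by blast
next
  case False
  define S where "S = (\<lambda>P. P ** M) ` W"
  define T where "T = {X::real^'n^'n. \<forall>x. x \<noteq> 0 \<longrightarrow> x \<bullet> (X *v x) < 0}"
  have lin: "linear (\<lambda>P::real^'n^'n. P ** M)"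
    by (rule linearI) (simp_all add: matrix_matrix_mult_def vec_eq_iff sum.distrib sum_distrib_left algebra_simps)
  have subS: "subspace S" unfolding S_def by (rule linear_subspace_image[OF lin W])
  have "convex T"
  proof (rule convexI)
    fix X Y :: "real^'n^'n" and u v :: real
    assume XY: "X \<in> T" "Y \<in> T" and uv: "0 \<le> u" "0 \<le> v" "u + v = 1"
    have "x \<bullet> ((u *\<^sub>R X + v *\<^sub>R Y) *v x) < 0" if "x \<noteq> 0" for x
    proof -
      have "x \<bullet> (X *v x) < 0" "x \<bullet> (Y *v x) < 0" using XY that by (auto simp: T_def)
      then have "u * (x \<bullet> (X *v x)) + v * (x \<bullet> (Y *v x)) < 0"
        using uv by (cases "u = 0") (auto simp: mult_less_0_iff mult_le_0_iff intro!: add_neg_nonpos)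
      then show ?thesis
        by (simp add: matrix_vector_mult_add_rdistrib scaleR_matrix_vector_assoc[symmetric] inner_add_right)
    qed
    then show "u *\<^sub>R X + v *\<^sub>R Y \<in> T" by (simp add: T_def)
  qed
  \<comment> \<open>Matrices with negative semidefinite form are limits of members of T, so the sign
    of the functional extends to them by approximation.\<close>
  have shift: "X - e *\<^sub>R mat 1 \<in> T" if "\<And>x. x \<bullet> (X *v x) \<le> 0" "e > 0" for X e
  proof -
    have "x \<bullet> ((X - e *\<^sub>R mat 1) *v x) < 0" if "x \<noteq> 0" for x
    proof -
      have "x \<bullet> ((X - e *\<^sub>R mat 1) *v x) = x \<bullet> (X *v x) - e * (x \<bullet> x)"
        by (simp add: matrix_vector_mult_diff_rdistrib scaleR_matrix_vector_assoc[symmetric] inner_diff_right)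
      moreover have "e * (x \<bullet> x) > 0" using \<open>e > 0\<close> that by simp
      ultimately show ?thesis using \<open>x \<bullet> (X *v x) \<le> 0\<close> by linarith
    qed
    then show ?thesis by (simp add: T_def)
  qed
  have "T \<noteq> {}" using shift[of 0 1] by auto
  moreover have "S \<inter> T = {}"
    using False by (auto simp: S_def T_def simp flip: matrix_vector_mul_assoc)
  moreover have "S \<noteq> {}" using subspace_0[OF subS] by blast
  ultimately obtain a b where ab: "a \<noteq> 0" "\<forall>x\<in>S. a \<bullet> x \<le> b" "\<forall>x\<in>T. a \<bullet> x \<ge> b"
    using separating_hyperplane_sets[OF subspace_imp_convex[OF subS] \<open>convex T\<close>] by blast
  have b: "b \<ge> 0" using ab(2) subspace_0[OF subS] by force
  have S0: "a \<bullet> x = 0" if "x \<in> S" for x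
  proof (rule ccontr)
    assume n: "a \<bullet> x \<noteq> 0"
    \<comment> \<open>A functional bounded above on a subspace vanishes there: this multiple of x
      would attain b + 1.\<close>
    have "((b + 1) / (a \<bullet> x)) *\<^sub>R x \<in> S" using subspace_scale[OF subS that] .
    then have "a \<bullet> (((b + 1) / (a \<bullet> x)) *\<^sub>R x) \<le> b" using ab(2) by blast
    then show False using n by simp
  qed
  have nsd: "a \<bullet> X \<ge> 0" if "\<And>x. x \<bullet> (X *v x) \<le> 0" for X
  proof (rule field_le_epsilon)
    fix e :: real assume e: "e > 0"
    define c where "c = e / (1 + \<bar>a \<bullet> mat 1\<bar>)"
    have c: "c > 0" using e by (simp add: c_def add_pos_nonneg)
    have "0 \<le> a \<bullet> (X - c *\<^sub>R mat 1)" using ab(3) b shift[OF that c] by force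
    have "0 \<le> a \<bullet> X - c * (a \<bullet> mat 1)"
      using \<open>0 \<le> a \<bullet> (X - c *\<^sub>R mat 1)\<close> by (simp add: inner_diff_right)
    moreover have "- (c * (a \<bullet> mat 1)) \<le> c * (1 + \<bar>a \<bullet> mat 1\<bar>)"
      using mult_left_mono[of "- (a \<bullet> mat 1)" "1 + \<bar>a \<bullet> mat 1\<bar>" c] c by simp
    moreover have "c * (1 + \<bar>a \<bullet> mat 1\<bar>) = e" by (simp add: c_def)
    ultimately show "0 \<le> a \<bullet> X + e" by linarith
  qed
  show ?thesis
  proof (rule dual[of "- a"])
    show "- a \<noteq> 0" using ab(1) by simp
    have m: "(- a) *v y = - (a *v y)" for y by (simp add: matrix_vector_mult_def vec_eq_iff sum_negf)
    show "x \<bullet> ((- a) *v y) = y \<bullet> ((- a) *v x)" for x y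
    proof -
      \<comment> \<open>The form of x y^T - y x^T is identically zero, so the functional is
        nonnegative on this matrix and on its negative. Hence it vanishes there, which is
        symmetry.\<close>
      have q: "z \<bullet> ((outer x y - outer y x) *v z) = 0" for x y z :: "real^'n"
        by (simp add: matrix_vector_mult_diff_rdistrib outer_mult_vector inner_diff_right inner_commute)
      have "a \<bullet> (outer x y - outer y x) \<ge> 0" "a \<bullet> (outer y x - outer x y) \<ge> 0"
        by (intro nsd; simp add: q)+
      then show ?thesis by (simp add: inner_diff_right inner_outer m)
    qed
    show "x \<bullet> ((- a) *v x) \<ge> 0" for x
    proof -
      have "a \<bullet> (outer (- x) x) \<ge> 0"
        by (intro nsd) (simp add: outer_mult_vector inner_commute)
      then show ?thesis by (simp add: inner_outer m)
    qed
    show "(- a) \<bullet> (P ** M) = 0" if "P \<in> W" for P using S0[of "P ** M"] that by (simp add: S_def)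
  qed
qed

section \<open>Exponential decay\<close>

text \<open>The interval is cut at one exceptional point after another; continuity joins the
  pieces.\<close>

lemma nonincreasing_finite_exceptions:
  fixes f :: "real \<Rightarrow> real"
  assumes "finite S" "a \<le> b" "continuous_on {a..b} f"
    and "\<And>t. a < t \<Longrightarrow> t < b \<Longrightarrow> t \<notin> S \<Longrightarrow> \<exists>D. (f has_real_derivative D) (at t) \<and> D \<le> 0"
  shows "f b \<le> f a"
  using assms
proof (induction S arbitrary: a b rule: finite_induct)
  case empty
  then show ?case
    by (cases "a = b") (auto intro!: DERIV_nonpos_imp_decreasing_open[of a b f])
next
  case (insert s S)
  show ?case
  proof (cases "a < s \<and> s < b")
    case True
    have "f b \<le> f s" "f s \<le> f a"
      using True insert.prems by (auto intro!: insert.IH elim: continuous_on_subset)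
    then show ?thesis by simp
  next
    case False
    then show ?thesis using insert.prems by (intro insert.IH) auto
  qed
qed

lemma positive_definite_lower_bound:
  fixes X :: "real^'n::finite^'n"
  assumes pos: "\<And>x. x \<noteq> 0 \<Longrightarrow> x \<bullet> (X *v x) > 0"
  obtains c where "c > 0" "\<And>x. x \<bullet> (X *v x) \<ge> c * (norm x)\<^sup>2"
proof -
  have "\<exists>u\<in>sphere 0 1. \<forall>x\<in>sphere (0::real^'n) 1. u \<bullet> (X *v u) \<le> x \<bullet> (X *v x)"
    by (intro continuous_attains_inf continuous_on_inner continuous_on_id linear_continuous_on
        matrix_vector_mul_bounded_linear) auto
  then obtain u :: "real^'n" where u: "norm u = 1" "\<And>x. norm x = 1 \<Longrightarrow> u \<bullet> (X *v u) \<le> x \<bullet> (X *v x)"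
    by auto
  have "u \<noteq> 0" using u(1) by auto
  then have c: "u \<bullet> (X *v u) > 0" by (rule pos)
  have "x \<bullet> (X *v x) \<ge> (u \<bullet> (X *v u)) * (norm x)\<^sup>2" for x
  proof (cases "x = 0")
    case False
    have "u \<bullet> (X *v u) \<le> (x /\<^sub>R norm x) \<bullet> (X *v (x /\<^sub>R norm x))"
      using False by (intro u(2)) simp
    also have "\<dots> = (x \<bullet> (X *v x)) / (norm x)\<^sup>2"
      by (simp add: matrix_vector_mult_scaleR power2_eq_square divide_inverse)
    finally show ?thesis using False by (simp add: pos_le_divide_eq)
  qed simp
  then show ?thesis using that c by blast
qed

lemma matrix_vector_norm_bound:
  fixes X :: "real^'n::finite^'n"
  obtains K where "K > 0" "\<And>x. norm (X *v x) \<le> K * norm x"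
proof -
  have "bounded_linear ((*v) X)" by (rule matrix_vector_mul_bounded_linear)
  then show ?thesis
    using that bounded_linear.pos_bounded[of "(*v) X"] by (auto simp: mult.commute)
qed

text \<open>exp (2 \<alpha> t) x^T P x is nonincreasing between switches, and also across them
  because x is continuous. The bounds c |x|^2 \<le> x^T P x \<le> K |x|^2 translate this into norms
  with \<beta> = sqrt (K / c), independent of the signal.\<close>

lemma GUES_of_quadratic_lyapunov:
  fixes E A :: "nat \<Rightarrow> real^'n::finite^'n"
  assumes sym: "\<And>x y. x \<bullet> (P *v y) = y \<bullet> (P *v x)"
    and pos: "\<And>x. x \<noteq> 0 \<Longrightarrow> x \<bullet> (P *v x) > 0"
    and \<alpha>: "\<alpha> > 0"
    and decay: "\<And>i x x'. i \<in> {1, 2} \<Longrightarrow> E i *v x' = A i *v x \<Longrightarrow>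
      x \<bullet> (P *v x') \<le> - \<alpha> * (x \<bullet> (P *v x))"
  shows "GUES E A"
proof -
  obtain c where c: "c > 0" "\<And>x. x \<bullet> (P *v x) \<ge> c * (norm x)\<^sup>2"
    using positive_definite_lower_bound[OF pos] by blast
  obtain K where K: "K > 0" "\<And>x. norm (P *v x) \<le> K * norm x"
    using matrix_vector_norm_bound by blast
  have up: "x \<bullet> (P *v x) \<le> K * (norm x)\<^sup>2" for x
  proof -
    have "x \<bullet> (P *v x) \<le> norm x * norm (P *v x)" by (rule norm_cauchy_schwarz)
    also have "\<dots> \<le> norm x * (K * norm x)" by (intro mult_left_mono K) simp
    finally show ?thesis by (simp add: power2_eq_square mult_ac)
  qed
  define \<beta> where "\<beta> = sqrt (K / c)"
  have \<beta>: "\<beta> > 0" using c K by (simp add: \<beta>_def)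
  have "norm (x t) \<le> \<beta> * exp (- \<alpha> * (t - t0)) * norm (x t0)"
    if \<sigma>: "switching_signal \<sigma>" and x: "switched_solution E A \<sigma> t0 x" and t: "t \<ge> t0" for \<sigma> t0 x t
  proof -
    define V where "V s = x s \<bullet> (P *v x s)" for s
    define f where "f s = exp (2 * \<alpha> * s) * V s" for s
    have cont: "continuous_on {t0..t} x"
      using x by (auto simp: switched_solution_def elim: continuous_on_subset)
    have "f t \<le> f t0"
    proof (rule nonincreasing_finite_exceptions[where f = f and a = t0 and b = t
          and S = "{s \<in> {t0..t}. \<not> isCont \<sigma> s}"])
      show "finite {s \<in> {t0..t}. \<not> isCont \<sigma> s}" using \<sigma> by (simp add: switching_signal_def)
      show "t0 \<le> t" by (rule t)
      have "continuous_on {t0..t} (\<lambda>s. P *v x s)"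
        by (rule bounded_linear.continuous_on[OF matrix_vector_mul_bounded_linear cont])
      then show "continuous_on {t0..t} f"
        unfolding f_def V_def by (intro continuous_intros cont)
      fix s assume s: "t0 < s" "s < t" "s \<notin> {s \<in> {t0..t}. \<not> isCont \<sigma> s}"
      then obtain x' where x': "(x has_vector_derivative x') (at s)" "E (\<sigma> s) *v x' = A (\<sigma> s) *v x s"
        using x by (auto simp: switched_solution_def)
      have d: "x s \<bullet> (P *v x') \<le> - \<alpha> * V s"
        unfolding V_def using \<sigma> x'(2) by (intro decay[of "\<sigma> s"]) (auto simp: switching_signal_def)
      have hx: "(x has_derivative (\<lambda>h. h *\<^sub>R x')) (at s)"
        using x'(1) by (simp add: has_vector_derivative_def)
      have hP: "((\<lambda>s. P *v x s) has_derivative (\<lambda>h. P *v (h *\<^sub>R x'))) (at s)"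
        by (rule bounded_linear.has_derivative[OF matrix_vector_mul_bounded_linear hx])
      have "(V has_derivative (\<lambda>h. x s \<bullet> (P *v (h *\<^sub>R x')) + (h *\<^sub>R x') \<bullet> (P *v x s))) (at s)"
        unfolding V_def by (rule has_derivative_inner[OF hx hP])
      also have "(\<lambda>h. x s \<bullet> (P *v (h *\<^sub>R x')) + (h *\<^sub>R x') \<bullet> (P *v x s))
          = (\<lambda>h. (2 * (x s \<bullet> (P *v x'))) * h)"
        using sym[of x' "x s"] by (simp add: matrix_vector_mult_scaleR fun_eq_iff algebra_simps)
      finally have hV: "(V has_real_derivative 2 * (x s \<bullet> (P *v x'))) (at s)"
        by (simp add: has_field_derivative_def)
      have "(f has_real_derivative
          exp (2 * \<alpha> * s) * (2 * \<alpha>) * V s + exp (2 * \<alpha> * s) * (2 * (x s \<bullet> (P *v x')))) (at s)"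
        unfolding f_def by (auto intro!: derivative_eq_intros hV)
      moreover have "exp (2 * \<alpha> * s) * (2 * \<alpha>) * V s + exp (2 * \<alpha> * s) * (2 * (x s \<bullet> (P *v x')))
          = 2 * exp (2 * \<alpha> * s) * (\<alpha> * V s + x s \<bullet> (P *v x'))"
        by (simp add: algebra_simps)
      moreover have "\<dots> \<le> 0" using d by (intro mult_nonneg_nonpos) auto
      ultimately show "\<exists>D. (f has_real_derivative D) (at s) \<and> D \<le> 0" by auto
    qed
    then have "V t \<le> exp (2 * \<alpha> * t0) / exp (2 * \<alpha> * t) * V t0"
      by (simp add: f_def field_simps)
    also have "exp (2 * \<alpha> * t0) / exp (2 * \<alpha> * t) = (exp (- \<alpha> * (t - t0)))\<^sup>2"
      by (simp add: exp_diff[symmetric] exp_double[symmetric] algebra_simps)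
    finally have Vt: "V t \<le> (exp (- \<alpha> * (t - t0)))\<^sup>2 * V t0" .
    have "c * (norm (x t))\<^sup>2 \<le> V t" unfolding V_def by (rule c)
    also note Vt
    also have "(exp (- \<alpha> * (t - t0)))\<^sup>2 * V t0 \<le> (exp (- \<alpha> * (t - t0)))\<^sup>2 * (K * (norm (x t0))\<^sup>2)"
      unfolding V_def by (intro mult_left_mono up) simp
    finally have "(norm (x t))\<^sup>2 \<le> (K / c) * ((exp (- \<alpha> * (t - t0)))\<^sup>2 * (norm (x t0))\<^sup>2)"
      using c(1) by (simp add: field_simps)
    also have "\<dots> = (\<beta> * exp (- \<alpha> * (t - t0)) * norm (x t0))\<^sup>2"
      using c(1) K(1) by (simp add: power_mult_distrib \<beta>_def)
    finally show ?thesis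
      by (rule power2_le_imp_le) (use \<beta> in simp)
  qed
  then show ?thesis unfolding GUES_def using \<beta> \<alpha> by blast
qed

section \<open>Indices of descriptor pencils and characteristic polynomials\<close>

text \<open>\<open>LEAST\<close> is informative only once a witness exists. The ranges form a
  decreasing chain of subspaces, and endless strict descent would exhaust the dimension.\<close>

lemma desc_index_range:
  shows "range (\<lambda>v. mpow (matrix_inv A ** E) (Suc (desc_index E A)) *v v)
       = range (\<lambda>v. mpow (matrix_inv A ** E) (desc_index E A) *v v)"
    and "k < desc_index E A \<Longrightarrow> range (\<lambda>v. mpow (matrix_inv A ** E) (Suc k) *v v)
       \<noteq> range (\<lambda>v. mpow (matrix_inv A ** E) k *v v)"
proof -
  define N where "N = matrix_inv A ** E"
  define r where "r k = range (\<lambda>v. mpow N k *v v)" for k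
  have sub: "subspace (r k)" for k
    unfolding r_def by (intro linear_subspace_image matrix_vector_mul_linear subspace_UNIV)
  have dec: "r (Suc k) \<subseteq> r k" for k
    unfolding r_def mpow_iterate by (auto simp: funpow_Suc_right simp del: funpow.simps(2))
  have "\<exists>k. r (Suc k) = r k"
  proof (rule ccontr)
    assume no: "\<not> ?thesis"
    have "dim (r k) + k \<le> dim (r 0)" for k
    proof (induction k)
      case (Suc k)
      have "dim (r (Suc k)) \<noteq> dim (r k)"
        using subspace_dim_equal[OF sub sub dec] no by (metis order_refl)
      then have "dim (r (Suc k)) < dim (r k)" using dim_subset[OF dec[of k]] by simp
      then show ?case using Suc by simp
    qed simp
    from this[of "Suc (dim (r 0))"] show False by simp
  qed
  then show "range (\<lambda>v. mpow (matrix_inv A ** E) (Suc (desc_index E A)) *v v)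
       = range (\<lambda>v. mpow (matrix_inv A ** E) (desc_index E A) *v v)"
    unfolding desc_index_def r_def N_def by (rule LeastI_ex)
  show "k < desc_index E A \<Longrightarrow> range (\<lambda>v. mpow (matrix_inv A ** E) (Suc k) *v v)
       \<noteq> range (\<lambda>v. mpow (matrix_inv A ** E) k *v v)"
    unfolding desc_index_def by (rule not_less_Least)
qed

lemma poly_charpoly: "poly (charpoly Q) x = det (\<chi> i j. (if i = j then x else 0) - Q$i$j)"
proof -
  have "poly (of_int k) x = of_int k" for k :: int and x :: real
    by (simp add: of_int_poly)
  then show ?thesis
    unfolding charpoly_def det_def
    by (simp add: poly_sum poly_prod) (intro sum.cong refl arg_cong2[of _ _ _ _ "(*)"] prod.cong; simp)
qed

lemma det_0_of_left_kernel:
  fixes D :: "'a::field^'n::finite^'n"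
  assumes "transpose D *v y = 0" "y \<noteq> 0"
  shows "det D = 0"
proof -
  have "\<not> invertible (transpose D)"
    using assms by (metis invertible_left_inverse matrix_left_invertible_ker)
  then show ?thesis by (simp add: invertible_det_nz det_transpose)
qed

lemma charpoly_root_of_left_eigenvector:
  assumes "transpose Q *v r = x *\<^sub>R r" "r \<noteq> 0"
  shows "poly (charpoly Q) x = 0"
proof -
  have "transpose (\<chi> i j. (if i = j then x else 0) - Q$i$j) = x *\<^sub>R mat 1 - transpose Q"
    by (auto simp: transpose_def mat_def vec_eq_iff)
  then have "transpose (\<chi> i j. (if i = j then x else 0) - Q$i$j) *v r = 0"
    using assms(1) by (simp add: matrix_vector_mult_diff_rdistrib scaleR_matrix_vector_assoc[symmetric])
  then show ?thesis unfolding poly_charpoly using assms(2) by (rule det_0_of_left_kernel)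
qed

section \<open>Descriptor pencils and the common Lyapunov matrix\<close>

lemma
  assumes "invertible A"
  shows matrix_inv_left: "matrix_inv A ** A = mat 1"
    and matrix_inv_right: "A ** matrix_inv A = mat 1"
proof -
  have "A ** matrix_inv A = mat 1 \<and> matrix_inv A ** A = mat 1"
    unfolding matrix_inv_def by (rule someI_ex) (use assms in \<open>simp add: invertible_def\<close>)
  then show "matrix_inv A ** A = mat 1" "A ** matrix_inv A = mat 1" by simp_all
qed

text \<open>Needed before \<open>order\<close> can be read as a multiplicity. K + 1 exceeds a bound
  on the operator norm of Q, so it is not an eigenvalue.\<close>

lemma charpoly_nonzero: "charpoly (Q::real^'n::finite^'n) \<noteq> 0"
proof -
  obtain K where K: "K > 0" "\<And>x. norm (Q *v x) \<le> K * norm x"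
    using matrix_vector_norm_bound by blast
  let ?C = "\<chi> i j. (if i = j then K + 1 else 0) - Q$i$j"
  have C: "?C = (K + 1) *\<^sub>R mat 1 - Q" by (auto simp: mat_def vec_eq_iff)
  have "u = 0" if "?C *v u = 0" for u
  proof (rule ccontr)
    assume "u \<noteq> 0"
    have "Q *v u = (K + 1) *\<^sub>R u"
      using that unfolding C
      by (simp add: matrix_vector_mult_diff_rdistrib scaleR_matrix_vector_assoc[symmetric])
    then have "(K + 1) * norm u \<le> K * norm u" using K(2)[of u] K(1) by simp
    then show False using \<open>u \<noteq> 0\<close> by (simp add: algebra_simps)
  qed
  then have "\<exists>B. B ** ?C = mat 1" by (simp only: matrix_left_invertible_ker) blast
  then have "invertible ?C" by (simp only: invertible_left_inverse)
  then have "poly (charpoly Q) (K + 1) \<noteq> 0"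
    unfolding poly_charpoly by (simp only: invertible_det_nz not_False_eq_True)
  then show ?thesis by auto
qed

text \<open>(x I - Q)(v + x y) = x^2 y, so by Cramer's rule \<open>charpoly\<close> times a
  component of v + x y carries a factor x^2. If 0 were a simple root, dividing by x and letting x
  tend to 0 would annihilate a nonzero component of v.\<close>

lemma order_0_charpoly_jordan_chain:
  fixes Q :: "real^'n::finite^'n"
  assumes "Q *v v = 0" "Q *v y = v" "v \<noteq> 0"
  shows "order 0 (charpoly Q) \<noteq> 1"
proof
  assume ord: "order 0 (charpoly Q) = 1"
  have "[:- 0, 1:] ^ 1 dvd charpoly Q" using order_1[of 0 "charpoly Q"] ord by simp
  then obtain q where q: "charpoly Q = [:0, 1:] * q" by (auto elim: dvdE)
  have "\<not> [:- 0, 1:] ^ Suc 1 dvd charpoly Q" using order_2[OF charpoly_nonzero, of 0 Q] ord by simp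
  have q0: "poly q 0 \<noteq> 0"
  proof
    assume "poly q 0 = 0"
    then have "[:0, 1:] dvd q" using poly_eq_0_iff_dvd[of q 0] by simp
    then have "[:0, 1:] * [:0, 1:] dvd charpoly Q" unfolding q by (rule mult_dvd_mono[OF dvd_refl])
    then show False using \<open>\<not> [:- 0, 1:] ^ Suc 1 dvd charpoly Q\<close> by simp
  qed
  obtain j where j: "v $ j \<noteq> 0" using assms(3) by (auto simp: vec_eq_iff)
  define C where "C x = (\<chi> i k. (if i = k then x else 0) - Q$i$k)" for x
  define D where "D x = det (\<chi> i k. if k = j then y$i else C x $ i $ k)" for x
  have C: "C x *v u = x *\<^sub>R u - Q *v u" for x u
  proof -
    have "C x = x *\<^sub>R mat 1 - Q" by (auto simp: C_def mat_def vec_eq_iff)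
    then show ?thesis by (simp add: matrix_vector_mult_diff_rdistrib scaleR_matrix_vector_assoc[symmetric])
  qed
  have key: "poly (charpoly Q) x * (v + x *\<^sub>R y) $ j = x\<^sup>2 * D x" for x
  proof -
    have Cy: "C x *v (v + x *\<^sub>R y) = x\<^sup>2 *\<^sub>R y"
      by (simp add: C matrix_vector_right_distrib matrix_vector_mult_scaleR assms power2_eq_square
          algebra_simps)
    have "poly (charpoly Q) x = det (C x)" by (simp only: poly_charpoly C_def)
    then have "poly (charpoly Q) x * (v + x *\<^sub>R y) $ j
        = det (\<chi> i k. if k = j then (x\<^sup>2 *\<^sub>R y) $ i else C x $ i $ k)"
      using cramer_lemma[where A = "C x" and x = "v + x *\<^sub>R y" and k = j]
      by (simp only: Cy mult.commute)
    \<comment> \<open>The scalar x^2 sits in column j; transposing makes it a row, out of which it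
      can be pulled.\<close>
    also have "\<dots> = det (transpose (\<chi> i k. if k = j then (x\<^sup>2 *\<^sub>R y) $ i else C x $ i $ k))"
      by (simp add: det_transpose)
    also have "transpose (\<chi> i k. if k = j then (x\<^sup>2 *\<^sub>R y) $ i else C x $ i $ k)
        = (\<chi> k. if k = j then x\<^sup>2 *s y else transpose (C x) $ k)"
      by (simp add: transpose_def vec_eq_iff)
    also have "det \<dots> = x\<^sup>2 * det (\<chi> k. if k = j then y else transpose (C x) $ k)"
      by (rule det_row_mul)
    also have "(\<chi> k. if k = j then y else transpose (C x) $ k)
        = transpose (\<chi> i k. if k = j then y $ i else C x $ i $ k)"
      by (simp add: transpose_def vec_eq_iff)
    finally show ?thesis by (simp add: det_transpose D_def)
  qed
  have eq: "poly q x * (v + x *\<^sub>R y) $ j = x * D x" if "x \<noteq> 0" for x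
  proof -
    have "x * (poly q x * (v + x *\<^sub>R y) $ j) = x * (x * D x)"
      using key[of x] by (simp add: q power2_eq_square algebra_simps)
    then show ?thesis using that by simp
  qed
  \<comment> \<open>The divided identity holds only for x \<noteq> 0, so its value at 0 is reached
    through continuity of D.\<close>
  have entries: "isCont (\<lambda>x. (\<chi> i k. if k = j then y$i else C x $ i $ k) $ a $ b) 0" for a b
    by (cases "b = j"; cases "a = b") (simp_all add: C_def)
  have "isCont D 0" unfolding D_def det_def
    by (intro continuous_sum continuous_mult continuous_prod continuous_const entries)
  then have "((\<lambda>x. x * D x) \<longlongrightarrow> 0 * D 0) (at 0)"
    by (intro tendsto_intros) (simp add: isCont_def)
  moreover have "eventually (\<lambda>x. x * D x = poly q x * (v + x *\<^sub>R y) $ j) (at 0)"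
    using eq by (auto simp: eventually_at_filter)
  ultimately have "((\<lambda>x. poly q x * (v + x *\<^sub>R y) $ j) \<longlongrightarrow> 0) (at 0)"
    by (simp add: tendsto_cong)
  moreover have "((\<lambda>x. poly q x * (v + x *\<^sub>R y) $ j) \<longlongrightarrow> poly q 0 * (v + 0 *\<^sub>R y) $ j) (at 0)"
    by (intro tendsto_intros)
  ultimately have "poly q 0 * (v + 0 *\<^sub>R y) $ j = 0" using LIM_unique by blast
  then show False using q0 j by simp
qed

text \<open>An eigenvalue \<mu> of M^T yields the root s = 1 / \<mu> of det (s E - A): at y = A^(-T)
  r the transposed pencil gives s \<mu> r - r = 0. Inversion preserves the sign of the real
  part.\<close>

lemma desc_stable_eigenvalue:
  fixes A E :: "real^'n::finite^'n"
  assumes A: "invertible A" and M: "M = matrix_inv A ** E" "invertible M"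
    and stable: "desc_stable E A"
    and r: "r \<noteq> 0" "cmat (transpose M) *v r = \<mu> *s r"
  shows "Re \<mu> < 0"
proof -
  have tr: "transpose X ** transpose (matrix_inv X) = mat 1"
    "transpose (matrix_inv X) ** transpose X = mat 1" if "invertible X" for X :: "real^'n^'n"
    using matrix_inv_left[OF that] matrix_inv_right[OF that]
    by (simp_all add: matrix_transpose_mul[symmetric])
  have \<mu>0: "\<mu> \<noteq> 0"
  proof
    assume "\<mu> = 0"
    then have "cmat (transpose (matrix_inv M)) *v (cmat (transpose M) *v r) = 0" using r by simp
    then have "r = 0" by (simp add: matrix_vector_mul_assoc tr M(2) flip: cmat_mult)
    then show False using r by simp
  qed
  define s where "s = inverse \<mu>"
  define y where "y = cmat (transpose (matrix_inv A)) *v r"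
  have Ay: "cmat (transpose A) *v y = r"
    by (simp add: y_def matrix_vector_mul_assoc tr A flip: cmat_mult)
  have "cmat (transpose E) *v y = cmat (transpose M) *v r"
    by (simp add: y_def M(1) matrix_vector_mul_assoc matrix_transpose_mul flip: cmat_mult)
  then have Ey: "cmat (transpose E) *v y = \<mu> *s r" using r by simp
  let ?D = "\<chi> i j. s * complex_of_real (E$i$j) - complex_of_real (A$i$j)"
  have "transpose ?D *v z = s *s (cmat (transpose E) *v z) - cmat (transpose A) *v z" for z
    by (simp add: transpose_def cmat_def matrix_vector_mult_def vec_eq_iff sum_subtractf
        sum_distrib_left algebra_simps)
  then have "transpose ?D *v y = 0" using \<mu>0 by (simp add: Ay Ey s_def)
  moreover have "y \<noteq> 0" using Ay r by auto
  ultimately have "det ?D = 0" by (rule det_0_of_left_kernel)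
  then have "Re s < 0" using stable unfolding desc_stable_def by blast
  moreover have "(Re \<mu>)\<^sup>2 + (Im \<mu>)\<^sup>2 \<ge> 0" by simp
  ultimately show ?thesis unfolding s_def by (auto simp: divide_less_0_iff)
qed

text \<open>The Krylov space of M v is the image under M of that of v, and M is injective. This
  passes controllability from g = M v to v.\<close>

lemma controllable_preimage:
  assumes "invertible M" "controllable M (M *v v)"
  shows "span {mpow M k *v v | k. k < CARD('n)} = (UNIV :: (real^'n::finite) set)"
proof -
  let ?B = "{mpow M k *v v | k. k < CARD('n)}"
  have "{mpow M k *v (M *v v) | k. k < CARD('n)} = (*v) M ` ?B"
    unfolding mpow_iterate by (auto simp: funpow_swap1[symmetric])
  then have surj: "(*v) M ` span ?B = UNIV"
    using assms(2) by (simp add: controllable_def linear_span_image)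
  have inj: "inj ((*v) M)" using assms(1) by (rule inj_matrix_vector_mult)
  have "x \<in> span ?B" for x
    using inj_image_mem_iff[OF inj, of x "span ?B"] unfolding surj by simp
  then show ?thesis by blast
qed

text \<open>By dimension some a is orthogonal to v, ..., M^(n-2) v. It cannot also be orthogonal to
  M^(n-1) v, and dividing by that product normalizes it.\<close>

lemma cyclic_pair_exists:
  fixes M :: "real^'n::finite^'n"
  assumes sp: "span {mpow M k *v v | k. k < CARD('n)} = UNIV"
  obtains a0 where "cyclic_pair M v a0"
proof -
  let ?n = "CARD('n) - 1"
  let ?K = "(\<lambda>k. mpow M k *v v) ` {..<?n}"
  have "dim ?K \<le> card ?K" by (rule dim_le_card') simp
  also have "\<dots> \<le> ?n" using card_image_le[of "{..<?n}" "\<lambda>k. mpow M k *v v"] by simp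
  also have "\<dots> < DIM(real^'n)" by simp
  finally obtain a where a: "a \<noteq> 0" "\<And>y. y \<in> span ?K \<Longrightarrow> orthogonal a y"
    using orthogonal_to_subspace_exists[of ?K] by blast
  have ak: "a \<bullet> (mpow M k *v v) = 0" if "k < ?n" for k
    using a(2)[of "mpow M k *v v"] that by (auto simp: orthogonal_def intro: span_base)
  define c where "c = a \<bullet> (mpow M ?n *v v)"
  have c: "c \<noteq> 0"
  proof
    assume "c = 0"
    then have "a \<bullet> (mpow M k *v v) = 0" if "k < CARD('n)" for k
      using ak[of k] that by (cases "k = ?n") (auto simp: c_def)
    then have "a = 0" by (intro dot_eq_0_of_span[OF sp]) auto
    then show False using a(1) by simp
  qed
  have "cyclic_pair M v (inverse c *\<^sub>R a)"
  proof
    fix k assume "k < CARD('n)"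
    then show "(inverse c *\<^sub>R a) \<bullet> (mpow M k *v v) = (if Suc k = CARD('n) then 1 else 0)"
      using ak[of k] c by (cases "k = ?n") (auto simp: c_def)
  qed (rule sp)
  then show ?thesis by (rule that)
qed

text \<open>The alternative is applied to the symmetric P with N^T P v = 0, that is, with P v
  orthogonal to the range of N. Suitable rank-one and rank-two members of this space supply the
  conditions that make a dual Z vanish.\<close>

lemma common_lyapunov_matrix:
  fixes M N :: "real^'n::finite^'n"
  assumes inv: "invertible M" and N: "N = M - outer (M *v v) h"
    and ctrb: "controllable M (M *v v)"
    and w: "transpose M *v w = h" and hv: "h \<bullet> v = 1" and wv: "w \<bullet> v \<noteq> 0"
    and stable: "\<And>\<mu> r. r \<noteq> 0 \<Longrightarrow> cmat (transpose M) *v r = \<mu> *s r \<Longrightarrow> Re \<mu> < 0"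
    and no_neg: "\<And>y r. y > 0 \<Longrightarrow> r \<noteq> 0 \<Longrightarrow> transpose (M ** N) *v r \<noteq> - y *\<^sub>R r"
    and simple: "\<And>u. transpose M *v u = w \<Longrightarrow> u \<bullet> v \<noteq> 0"
  obtains P where "\<And>x y. x \<bullet> (P *v y) = y \<bullet> (P *v x)" "\<And>x. x \<noteq> 0 \<Longrightarrow> x \<bullet> (P *v x) > 0"
    "\<And>x. x \<noteq> 0 \<Longrightarrow> x \<bullet> (P *v (M *v x)) < 0" "transpose N *v (P *v v) = 0"
proof -
  obtain a0 where "cyclic_pair M v a0"
    using cyclic_pair_exists[OF controllable_preimage[OF inv ctrb]] by blast
  then interpret cyclic_pair M v a0 .
  have TN: "transpose N *v x = transpose M *v x - ((M *v v) \<bullet> x) *\<^sub>R h" for x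
  proof -
    have "transpose N = transpose M - outer h (M *v v)"
      by (simp add: N transpose_def outer_def vec_eq_iff mult.commute)
    then show ?thesis by (simp add: matrix_vector_mult_diff_rdistrib outer_mult_vector)
  qed
  have no_neg': "transpose M *v (transpose M *v r) - ((M *v v) \<bullet> (transpose M *v r)) *\<^sub>R h \<noteq> - y *\<^sub>R r"
    if "y > 0" "r \<noteq> 0" for y r
    using no_neg[OF that] by (simp add: matrix_transpose_mul TN flip: matrix_vector_mul_assoc)
  have "(M *v v) \<bullet> w = 1"
    using inner_transpose_vector[of w M v] by (simp add: w hv inner_commute)
  then have TNw: "transpose N *v w = 0" by (simp add: TN w)
  define W where "W = {P. transpose P = P \<and> transpose N *v (P *v v) = 0}"
  have "subspace W"
    unfolding W_def subspace_def
    by (auto simp: transpose_def vec_eq_iff matrix_vector_mult_add_rdistrib matrix_vector_right_distrib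
        matrix_vector_mult_scaleR scaleR_matrix_vector_assoc[symmetric])
  then show ?thesis
  proof (cases rule: negative_definite_product_or_dual[of W M])
    case (primal P)
    have sym: "x \<bullet> (P *v y) = y \<bullet> (P *v x)" for x y
      using primal(1) inner_transpose_vector[of x P y] by (simp add: W_def inner_commute)
    obtain p where p: "degree p = CARD('n)" "\<phi> p = 0" using annihilating_poly by blast
    have "p \<noteq> 0" using p(1) by auto
    have pos: "x \<bullet> (P *v x) > 0" if "x \<noteq> 0" for x
    proof (rule lyapunov_positive_definite[OF \<open>p \<noteq> 0\<close> phi_zero_annihilates[OF p(2)] _ sym primal(2) that])
      show "Re z < 0" if "poly (map_poly complex_of_real p) z = 0" for z
        using annihilator_root_eigenvector[OF p(2,1) that] stable by blast
    qed
    show ?thesis using that[OF sym pos primal(2)] primal(1) by (simp add: W_def)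
  next
    case (dual Z)
    have skew: "a \<bullet> (Z *v (transpose M *v b)) + b \<bullet> (Z *v (transpose M *v a)) = 0"
      if "a \<bullet> v = 0" "b \<bullet> v = 0" for a b
    proof -
      \<comment> \<open>Since a and b are orthogonal to v, this matrix kills v; orthogonality of Z
        to its product with M is the skew condition.\<close>
      have "outer a b + outer b a \<in> W"
      proof -
        have "transpose (outer a b + outer b a) = outer a b + outer b a"
          by (simp add: transpose_def outer_def vec_eq_iff mult.commute)
        moreover have "(outer a b + outer b a) *v v = 0"
          using that by (simp add: matrix_vector_mult_add_rdistrib outer_mult_vector)
        ultimately show ?thesis by (simp add: W_def)
      qed
      from dual(4)[OF this] have "Z \<bullet> (outer a b ** M + outer b a ** M) = 0"
        by (simp add: matrix_matrix_mult_def vec_eq_iff sum.distrib algebra_simps plus_vec_def)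
      then show ?thesis by (simp add: outer_mult_matrix inner_add_right inner_outer)
    qed
    \<comment> \<open>N^T w = 0 admits w w^T, and (w w^T) M = w h^T.\<close>
    have "outer w w \<in> W"
      by (simp add: W_def transpose_outer outer_mult_vector matrix_vector_mult_scaleR TNw)
    from dual(4)[OF this] have wZh: "w \<bullet> (Z *v h) = 0"
      by (simp add: outer_mult_matrix inner_outer w)
    have "Z *v x = 0" for x
      by (rule dual_cone_trivial[OF dual(2,3) skew w hv wv wZh stable no_neg' simple])
    then have "Z = 0" by (simp add: matrix_eq)
    then show ?thesis using dual(1) by simp
  qed
qed

section \<open>From the index and eigenvalue hypotheses to the decay estimate\<close>

theorem theorem3:
  fixes E A :: "nat \<Rightarrow> real^'n::finite^'n"
    and g h :: "real^'n"
  assumes "invertible (A 1)" and "invertible (A 2)"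
    and "desc_stable (E 1) (A 1)" and "desc_stable (E 2) (A 2)"
    and "desc_index (E 1) (A 1) = 0" and "desc_index (E 2) (A 2) = 1"
    and "matrix_inv (A 2) ** E 2 = matrix_inv (A 1) ** E 1 - (\<chi> i j. g$i * h$j)"
    and "controllable (matrix_inv (A 1) ** E 1) g"
    and "observable h (matrix_inv (A 1) ** E 1)"
    and "\<not> (\<exists>l::real. l < 0 \<and>
            poly (charpoly (matrix_inv (A 1) ** E 1 ** (matrix_inv (A 2) ** E 2))) l = 0)"
    and "order 0 (charpoly (matrix_inv (A 1) ** E 1 ** (matrix_inv (A 2) ** E 2))) = 1"
  shows "GUES E A"
proof -
  define M where "M = matrix_inv (A 1) ** E 1"
  define N where "N = matrix_inv (A 2) ** E 2"
  have NM: "N = M - outer g h" using assms(7) by (simp add: M_def N_def outer_def)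
  have Nx: "N *v x = M *v x - (h \<bullet> x) *\<^sub>R g" for x
    by (simp add: NM matrix_vector_mult_diff_rdistrib outer_mult_vector)
  have "range ((*v) M) = UNIV"
    using desc_index_range(1)[where A = "A 1" and E = "E 1"] assms(5) by (simp add: M_def)
  then have "surj ((*v) M)" .
  then have inv: "invertible M"
    by (metis matrix_right_invertible_surjective matrix_left_right_inverse invertible_def)
  have Minv: "matrix_inv M *v (M *v x) = x" "M *v (matrix_inv M *v x) = x" for x
    by (simp_all add: matrix_vector_mul_assoc matrix_inv_left matrix_inv_right inv)
  have not_inv: "\<not> invertible N"
  proof
    assume "invertible N"
    then have "surj ((*v) N)"
      by (metis matrix_right_invertible_surjective invertible_def)
    then show False
      using desc_index_range(2)[where A = "A 2" and E = "E 2" and k = 0] assms(6) by (simp add: N_def)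
  qed
  have range2: "range (\<lambda>x. N *v (N *v x)) = range ((*v) N)"
    using desc_index_range(1)[where A = "A 2" and E = "E 2"] assms(6)
    by (simp add: N_def numeral_2_eq_2 flip: matrix_vector_mul_assoc)
  define v where "v = matrix_inv M *v g"
  have Mv: "M *v v = g" by (simp add: v_def Minv)
  \<comment> \<open>N x = 0 means M x = (h . x) g = M ((h . x) v), so the kernel is contained in the
    line through v.\<close>
  have ker: "x = (h \<bullet> x) *\<^sub>R v" if "N *v x = 0" for x
  proof -
    have "M *v x = M *v ((h \<bullet> x) *\<^sub>R v)" using that by (simp add: Nx Mv matrix_vector_mult_scaleR)
    then show ?thesis using Minv(1) by metis
  qed
  obtain x0 where x0: "x0 \<noteq> 0" "N *v x0 = 0"
    using not_inv by (metis invertible_left_inverse matrix_left_invertible_ker)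
  have hv: "h \<bullet> v = 1"
  proof -
    have "h \<bullet> x0 = (h \<bullet> x0) * (h \<bullet> v)" using arg_cong[OF ker[OF x0(2)], of "(\<bullet>) h"] by simp
    moreover have "h \<bullet> x0 \<noteq> 0" using ker[OF x0(2)] x0(1) by auto
    ultimately show ?thesis by simp
  qed
  have v0: "v \<noteq> 0" using hv by auto
  have Nv: "N *v v = 0" by (simp add: Nx Mv hv)
  \<comment> \<open>The left counterpart of v: g . w = h . v = 1 gives N^T w = 0.\<close>
  define w where "w = transpose (matrix_inv M) *v h"
  have w: "transpose M *v w = h"
    by (simp add: w_def matrix_vector_mul_assoc matrix_inv_left inv flip: matrix_transpose_mul)
  have wx: "w \<bullet> x = h \<bullet> (matrix_inv M *v x)" for x
    by (simp add: w_def inner_transpose_vector)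
  \<comment> \<open>Index one enters here. If w . v = 0, then v = N (M^(-1) v), so the kernel of N
    lies in its range; as N and N^2 have equal ranges, N would be surjective.\<close>
  have wv: "w \<bullet> v \<noteq> 0"
  proof
    assume "w \<bullet> v = 0"
    then have Nu: "N *v (matrix_inv M *v v) = v" by (simp add: Nx Minv wx)
    have "\<exists>z. x = N *v z" for x
    proof -
      obtain y where "N *v x = N *v (N *v y)" using range2 by (metis (no_types, lifting) imageE rangeI)
      then have "N *v (x - N *v y) = 0" by (simp add: matrix_vector_mult_diff_distrib)
      then obtain k where "x - N *v y = k *\<^sub>R v" using ker by blast
      then have "x = N *v (y + k *\<^sub>R (matrix_inv M *v v))"
        by (simp add: matrix_vector_right_distrib matrix_vector_mult_scaleR Nu algebra_simps)
      then show ?thesis by blast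
    qed
    then have "surj ((*v) N)" by (auto simp: surj_def)
    then show False using not_inv
      by (metis matrix_right_invertible_surjective matrix_left_right_inverse invertible_def)
  qed
  have stable: "Re \<mu> < 0" if "r \<noteq> 0" "cmat (transpose M) *v r = \<mu> *s r" for \<mu> r
    using desc_stable_eigenvalue[OF assms(1) M_def inv assms(3) that] .
  have no_neg: "transpose (M ** N) *v r \<noteq> - y *\<^sub>R r" if "y > 0" "r \<noteq> 0" for y r
    using charpoly_root_of_left_eigenvector[of "M ** N" r "- y"] that assms(10)
    by (auto simp: M_def N_def)
  \<comment> \<open>If u . v = 0, then y = M^(-2) v satisfies h . y = 0, hence M N y = M^2 y = v.
    This is a Jordan chain of M N at 0, against the simplicity of that eigenvalue.\<close>
  have simple: "u \<bullet> v \<noteq> 0" if u: "transpose M *v u = w" for u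
  proof
    assume "u \<bullet> v = 0"
    define y where "y = matrix_inv M *v (matrix_inv M *v v)"
    have "h \<bullet> y = w \<bullet> (matrix_inv M *v v)" by (simp add: y_def wx)
    also have "\<dots> = u \<bullet> v"
      by (simp add: u[symmetric] Minv flip: inner_transpose_vector)
    finally have "(M ** N) *v y = v"
      using \<open>u \<bullet> v = 0\<close> by (simp add: Nx y_def Minv flip: matrix_vector_mul_assoc)
    moreover have "(M ** N) *v v = 0" by (simp add: Nv flip: matrix_vector_mul_assoc)
    ultimately show False
      using order_0_charpoly_jordan_chain[of "M ** N" v y] v0 assms(11) unfolding M_def N_def by blast
  qed
  obtain P where P: "\<And>x y. x \<bullet> (P *v y) = y \<bullet> (P *v x)" "\<And>x. x \<noteq> 0 \<Longrightarrow> x \<bullet> (P *v x) > 0"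
    "\<And>x. x \<noteq> 0 \<Longrightarrow> x \<bullet> (P *v (M *v x)) < 0" "transpose N *v (P *v v) = 0"
  proof (rule common_lyapunov_matrix[of M N v h w])
    show "N = M - outer (M *v v) h" using NM by (simp only: Mv)
    show "controllable M (M *v v)" using assms(8) by (simp only: Mv flip: M_def)
  qed (use inv w hv wv stable no_neg simple in blast)+
  have minus_PM: "(- (P ** M)) *v x = - (P *v (M *v x))" for x
    by (simp add: matrix_vector_mul_assoc) (simp add: matrix_vector_mult_def vec_eq_iff sum_negf)
  have "x \<bullet> ((- (P ** M)) *v x) > 0" if "x \<noteq> 0" for x
    using P(3)[OF that] by (simp add: minus_PM)
  then obtain c where c: "c > 0" "\<And>x. x \<bullet> ((- (P ** M)) *v x) \<ge> c * (norm x)\<^sup>2"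
    using positive_definite_lower_bound[of "- (P ** M)"] by blast
  have PM: "x \<bullet> (P *v (M *v x)) \<le> - c * (norm x)\<^sup>2" for x
    using c(2)[of x] by (simp add: minus_PM)
  obtain K where K: "K > 0" "\<And>x. norm (M *v x) \<le> K * norm x" using matrix_vector_norm_bound by blast
  obtain L where L: "L > 0" "\<And>x. norm (P *v x) \<le> L * norm x" using matrix_vector_norm_bound by blast
  \<comment> \<open>For x = M y, x^T P x is at most L K^2 |y|^2 while y^T P M y is at most -c |y|^2;
    \<alpha> is the ratio of these constants.\<close>
  define \<alpha> where "\<alpha> = c / (K\<^sup>2 * L)"
  have \<alpha>: "\<alpha> > 0" using c K L by (simp add: \<alpha>_def)
  have V: "(M *v y) \<bullet> (P *v y) \<le> - \<alpha> * ((M *v y) \<bullet> (P *v (M *v y)))" for y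
  proof -
    have "(M *v y) \<bullet> (P *v (M *v y)) \<le> norm (M *v y) * norm (P *v (M *v y))"
      by (rule norm_cauchy_schwarz)
    also have "\<dots> \<le> norm (M *v y) * (L * norm (M *v y))" by (intro mult_left_mono L) simp
    also have "\<dots> = L * (norm (M *v y))\<^sup>2" by (simp add: power2_eq_square)
    also have "\<dots> \<le> L * (K * norm y)\<^sup>2" using L(1) by (intro mult_left_mono power_mono K) auto
    finally have "\<alpha> * ((M *v y) \<bullet> (P *v (M *v y))) \<le> \<alpha> * (L * (K * norm y)\<^sup>2)"
      using \<alpha> by (intro mult_left_mono) auto
    also have "\<dots> = c * (norm y)\<^sup>2" using K(1) L(1) by (simp add: \<alpha>_def power_mult_distrib)
    finally show ?thesis using PM[of y] P(1)[of "M *v y" y] by simp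
  qed
  have solve: "matrix_inv (A i) ** E i *v x' = x" if "invertible (A i)" "E i *v x' = A i *v x" for i x x'
    using that by (metis matrix_inv_left matrix_vector_mul_assoc matrix_vector_mul_lid)
  show ?thesis
  proof (rule GUES_of_quadratic_lyapunov[OF P(1,2) \<alpha>])
    fix i :: nat and x x' assume i: "i \<in> {1, 2}" and x: "E i *v x' = A i *v x"
    show "x \<bullet> (P *v x') \<le> - \<alpha> * (x \<bullet> (P *v x))"
    proof (cases "i = 1")
      case True
      then have "M *v x' = x" using solve[OF _ x] assms(1) by (simp add: M_def)
      then show ?thesis using V[of x'] by simp
    next
      case False
      then have Nx': "N *v x' = x" using i solve[OF _ x] assms(2) by (simp add: N_def)
      \<comment> \<open>y differs from x' by a kernel vector of N and satisfies h . y = 0, and M and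
        N agree on such vectors.\<close>
      define y where "y = x' - (h \<bullet> x') *\<^sub>R v"
      have "M *v y = x"
        using Nx' by (simp add: y_def Nx matrix_vector_mult_diff_distrib matrix_vector_mult_scaleR Mv)
      moreover have "x \<bullet> (P *v v) = 0"
        using P(4) inner_transpose_vector[of "P *v v" N x'] by (simp add: Nx' inner_commute)
      then have "x \<bullet> (P *v x') = x \<bullet> (P *v y)"
        by (simp add: y_def matrix_vector_mult_diff_distrib matrix_vector_mult_scaleR inner_diff_right)
      ultimately show ?thesis using V[of y] by simp
    qed
  qed
qed

end
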